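(* Let $\mathbf A\in\mathbb R^{m\times n}$ be nonzero and $\mathbf b\in\mathbb R^m$ (the system $\mathbf A\mathbf x=\mathbf b$ may be consistent or inconsistent). Assume that $0<\alpha_{\rm c}<2/\lambda_{\max}^{\rm c}$ and $0<\alpha_{\rm r}<2/\lambda_{\max}^{\rm r}$. For arbitrary $\mathbf x^0\in\mathbb R^n$, $\mathbf z^0\in\mathbf b+\mathrm{range}(\mathbf A)$, $\varepsilon>0$, and every $k\ge0$, the $k$th iterate $\mathbf x^k$ of the extended block row sampling iterative (EBRSI) algorithm with stepsizes $\alpha_{\rm c},\alpha_{\rm r}$ satisfies $$\mathbb E\left[\|\mathbf x^k-\mathbf x_\star^0\|^2\right]\leq(1+\varepsilon)^k\eta_{\rm r}^k\|\mathbf x^0-\mathbf x_\star^0\|^2+(1+1/\varepsilon)\alpha_{\rm r}^2\lambda_{\max}^{\rm r}\|\mathbf z^0-(\mathbf I-\mathbf A\mathbf A^\dagger)\mathbf b\|^2\sum_{i=0}^{k-1}\eta_{\rm c}^{k-i}(1+\varepsilon)^i\eta_{\rm r}^i,$$ where $$\eta_{\rm r}=1-\alpha_{\rm r}(2-\alpha_{\rm r}\lambda_{\max}^{\rm r})\sigma_{\min}^2(\mathbf A),\qquad \eta_{\rm c}=1-\alpha_{\rm c}(2-\alpha_{\rm c}\lambda_{\max}^{\rm c})\sigma_{\min}^2(\mathbf A).$$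
   Context: Notation: $\|\cdot\|$ is the Euclidean norm, $\mathrm{range}(\mathbf A)$ is the column space, $\mathbf A^\dagger$ is the Moore--Penrose pseudoinverse, $\sigma_{\min}(\mathbf A)$ is the smallest nonzero singular value of $\mathbf A$, and $\lambda_{\max}(\cdot)$ is the largest eigenvalue of a symmetric matrix. Define $\mathbf x_\star^0:=\mathbf A^\dagger\mathbf b+(\mathbf I-\mathbf A^\dagger\mathbf A)\mathbf x^0$. EBRSI algorithm: let $\mathcal D_{\rm r}$ and $\mathcal D_{\rm c}$ be (discrete or continuous) distributions of random real matrices $\mathbf S$ with $m$ rows and $\mathbf T$ with $n$ rows, respectively (the numbers of columns may themselves be random), such that $\mathbb E[\mathbf S\mathbf S^\top]=\mathbf I$ and $\mathbb E[\mathbf T\mathbf T^\top]=\mathbf I$. Given (deterministic) $\mathbf z^0\in\mathbf b+\mathrm{range}(\mathbf A)$, $\mathbf x^0\in\mathbb R^n$ and stepsizes $\alpha_{\rm c},\alpha_{\rm r}>0$, for $k\ge1$, $$\mathbf z^k=\mathbf z^{k-1}-\alpha_{\rm c}\mathbf A\mathbf T\mathbf T^\top\mathbf A^\top\mathbf z^{k-1},\qquad \mathbf x^k=\mathbf x^{k-1}-\alpha_{\rm r}\mathbf A^\top\mathbf S\mathbf S^\top(\mathbf A\mathbf x^{k-1}-\mathbf b+\mathbf z^k),$$ where at each iteration fresh $\mathbf S\sim\mathcal D_{\rm r}$ and $\mathbf T\sim\mathcal D_{\rm c}$ are drawn, independent of each other and of all previous iterations. Define $\lambda_{\max}^{\rm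 r}=\max_{\mathbf S\sim\mathcal D_{\rm r}}\lambda_{\max}(\mathbf A^\top\mathbf S\mathbf S^\top\mathbf A)$ and $\lambda_{\max}^{\rm c}=\max_{\mathbf T\sim\mathcal D_{\rm c}}\lambda_{\max}(\mathbf A\mathbf T\mathbf T^\top\mathbf A^\top)$, the maxima being over the possible realizations of $\mathbf S$ and $\mathbf T$; these maxima are assumed to exist (in particular to be finite). *)

theory Defs
  imports "HOL-Probability.Probability"
begin

subsection \<open>Linear algebra\<close>

definition eigenvalues :: "real^'n^'n \<Rightarrow> real set" where
  "eigenvalues W = {l. \<exists>v. v \<noteq> 0 \<and> W *v v = l *\<^sub>R v}"

text \<open>Used for symmetric matrices only, whose set of eigenvalues is finite and nonempty.\<close>

definition lambda_max :: "real^'n^'n \<Rightarrow> real" where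
  "lambda_max W = Max (eigenvalues W)"

definition singular_values :: "real^'n^'m \<Rightarrow> real set" where
  "singular_values A = sqrt ` eigenvalues (transpose A ** A)"

definition sigma_min :: "real^'n^'m \<Rightarrow> real" where
  "sigma_min A = Min (singular_values A - {0})"

text \<open>The Moore--Penrose pseudoinverse, as the unique solution of the four Penrose equations.\<close>

definition pinv :: "real^'n^'m \<Rightarrow> real^'m^'n" where
  "pinv A = (THE X. A ** X ** A = A \<and> X ** A ** X = X \<and>
     transpose (A ** X) = A ** X \<and> transpose (X ** A) = X ** A)"

definition x_star :: "real^'n^'m \<Rightarrow> real^'m \<Rightarrow> real^'n \<Rightarrow> real^'n" where
  "x_star A b x0 = pinv A *v b + (mat 1 - pinv A ** A) *v x0"


subsection \<open>Random matrices with a variable number of columns\<close>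

text \<open>
  A matrix with rows indexed by \<open>'m\<close> and an arbitrary finite number of columns is represented
  by the list of its columns, so that entry \<open>(i, j)\<close> of \<open>S\<close> is \<open>S ! j $ i\<close>.
  The next function is \<open>S S\<^sup>T\<close>.
\<close>

type_synonym 'm block = "(real^'m) list"

definition mult_transpose :: "'m::finite block \<Rightarrow> real^'m^'m" where
  "mult_transpose S = (\<chi> i l. \<Sum>j<length S. S ! j $ i * S ! j $ l)"

text \<open>
  The matrices with \<open>p\<close> columns carry the Borel sets of the \<open>p\<close>-fold product of \<open>real^'m\<close>,
  and the whole space is the disjoint union over \<open>p\<close>.
\<close>

definition block_borel :: "'m::finite block measure" where
  "block_borel = sigma UNIV
     {{S. length S = p \<and> (\<forall>j<p. S ! j \<in> X j)} | p X. \<forall>j. X j \<in> sets borel}"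

definition sampling_distribution :: "'m::finite block measure \<Rightarrow> bool" where
  "sampling_distribution D \<longleftrightarrow> prob_space D \<and> sets D = sets block_borel \<and>
     has_bochner_integral D mult_transpose (mat 1)"

text \<open>
  The possible realizations of a random matrix with distribution \<open>D\<close> are the points of the
  topological support of \<open>D\<close>: every neighbourhood (within the matrices having the same number
  of columns) has positive probability.
\<close>

definition realizations :: "'m::finite block measure \<Rightarrow> 'm block set" where
  "realizations D = {S. \<forall>e>0. measure D
     {S'. length S' = length S \<and> (\<forall>j<length S. dist (S' ! j) (S ! j) < e)} > 0}"

definition lambda_values_r :: "real^'n^'m \<Rightarrow> 'm::finite block measure \<Rightarrow> real set" where
  "lambda_values_r A Dr =
     (\<lambda>S. lambda_max (transpose A ** mult_transpose S ** A)) ` realizations Dr"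

definition lambda_values_c :: "real^'n^'m \<Rightarrow> 'n::finite block measure \<Rightarrow> real set" where
  "lambda_values_c A Dc =
     (\<lambda>T. lambda_max (A ** mult_transpose T ** transpose A)) ` realizations Dc"

text \<open>\<open>Max\<close> is meaningful for finite sets only, while these sets of values may be infinite.\<close>

definition is_maximum :: "real set \<Rightarrow> real \<Rightarrow> bool" where
  "is_maximum X l \<longleftrightarrow> l \<in> X \<and> (\<forall>y\<in>X. y \<le> l)"


subsection \<open>The EBRSI iteration\<close>

text \<open>
  The iterates for given sequences of sampled matrices; entry \<open>k\<close> of \<open>T\<close> and \<open>S\<close> is the matrix
  used in the \<open>k\<close>th iteration, so entry \<open>0\<close> is unused.
\<close>

primrec ebrsi_z ::
  "real^'n^'m \<Rightarrow> real \<Rightarrow> real^'m \<Rightarrow> (nat \<Rightarrow> 'n::finite block) \<Rightarrow> nat \<Rightarrow> real^'m::finite" where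
  "ebrsi_z A ac z0 T 0 = z0"
| "ebrsi_z A ac z0 T (Suc k) = ebrsi_z A ac z0 T k -
     ac *\<^sub>R ((A ** mult_transpose (T (Suc k)) ** transpose A) *v ebrsi_z A ac z0 T k)"

primrec ebrsi_x ::
  "real^'n^'m \<Rightarrow> real^'m \<Rightarrow> real \<Rightarrow> real \<Rightarrow> real^'m \<Rightarrow> real^'n \<Rightarrow>
   (nat \<Rightarrow> 'n::finite block) \<Rightarrow> (nat \<Rightarrow> 'm::finite block) \<Rightarrow> nat \<Rightarrow> real^'n" where
  "ebrsi_x A b ac ar z0 x0 T S 0 = x0"
| "ebrsi_x A b ac ar z0 x0 T S (Suc k) = ebrsi_x A b ac ar z0 x0 T S k -
     ar *\<^sub>R ((transpose A ** mult_transpose (S (Suc k))) *v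
       (A *v ebrsi_x A b ac ar z0 x0 T S k - b + ebrsi_z A ac z0 T (Suc k)))"

text \<open>
  \<open>S k\<close> and \<open>T k\<close> for \<open>k \<ge> 1\<close> are random matrices with distributions \<open>Dr\<close> and \<open>Dc\<close>, all of
  them jointly independent: the pairs are independent over the iterations, and the two components
  of each pair are independent. Since \<open>S k\<close> and \<open>T k\<close> have different types, \<open>indep_var\<close> does not
  apply to them, so the latter is stated for the \<open>\<sigma>\<close>-algebras they generate.
\<close>

definition ebrsi_samples ::
  "'a measure \<Rightarrow> 'm::finite block measure \<Rightarrow> 'n::finite block measure \<Rightarrow>
   (nat \<Rightarrow> 'a \<Rightarrow> 'm block) \<Rightarrow> (nat \<Rightarrow> 'a \<Rightarrow> 'n block) \<Rightarrow> bool" where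
  "ebrsi_samples M Dr Dc S T \<longleftrightarrow>
     (\<forall>k\<ge>1. S k \<in> measurable M block_borel \<and> distr M block_borel (S k) = Dr \<and>
            T k \<in> measurable M block_borel \<and> distr M block_borel (T k) = Dc \<and>
            prob_space.indep_set M {S k -` X \<inter> space M |X. X \<in> sets block_borel}
              {T k -` Y \<inter> space M |Y. Y \<in> sets block_borel}) \<and>
     prob_space.indep_vars M (\<lambda>_. block_borel \<Otimes>\<^sub>M block_borel)
       (\<lambda>k \<omega>. (S k \<omega>, T k \<omega>)) {1..}"

definition eta :: "real^'n^'m \<Rightarrow> real \<Rightarrow> real \<Rightarrow> real" where
  "eta A alpha lam = 1 - alpha * (2 - alpha * lam) * (sigma_min A)\<^sup>2"

end

theory Submission
  imports Defs
begin

text \<open>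
  Write \<open>v\<^sub>k = x\<^sup>k - x\<^sub>\<star>\<close> and \<open>w\<^sub>k = z\<^sup>k - (I - A A\<^sup>\<dagger>) b\<close>. These errors stay in \<open>range(A\<^sup>T)\<close> and
  \<open>range(A)\<close>, where \<open>A\<close> and \<open>A\<^sup>T\<close> expand norms by at least \<open>\<sigma>\<^sub>m\<^sub>i\<^sub>n\<close>, and satisfy
  \<open>w\<^sub>k = (I - \<alpha>\<^sub>c A T T\<^sup>T A\<^sup>T) w\<^sub>k\<^sub>-\<^sub>1\<close> and
  \<open>v\<^sub>k = (I - \<alpha>\<^sub>r A\<^sup>T S S\<^sup>T A) v\<^sub>k\<^sub>-\<^sub>1 - \<alpha>\<^sub>r A\<^sup>T S S\<^sup>T w\<^sub>k\<close>.
  Almost every sample lies in the support of its distribution, so the Cauchy--Schwarz inequality for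
  the form \<open>S S\<^sup>T\<close> gives \<open>\<parallel>A\<^sup>T S S\<^sup>T y\<parallel>\<^sup>2 \<le> \<lambda> (y \<bullet> S S\<^sup>T y)\<close>, which is linear in \<open>S S\<^sup>T\<close> and hence can be
  averaged with \<open>E[S S\<^sup>T] = I\<close>. For fixed previous errors one iteration therefore contracts the
  expected \<open>\<parallel>w\<parallel>\<^sup>2\<close> by \<open>\<eta>\<^sub>c\<close>, and bounds that of \<open>\<parallel>v\<parallel>\<^sup>2\<close> by
  \<open>(1 + \<epsilon>) \<eta>\<^sub>r \<parallel>v\<parallel>\<^sup>2 + (1 + 1/\<epsilon>) \<alpha>\<^sub>r\<^sup>2 \<lambda>\<^sub>r \<eta>\<^sub>c \<parallel>w\<parallel>\<^sup>2\<close>. Since the law of the samples is a product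
  measure, Fubini iterates this bound.
\<close>

subsection \<open>Symmetric matrices and the pseudoinverse\<close>

text \<open>As a simp rule this would turn \<open>transpose B *v x\<close> into
  \<open>x v* B\<close>; all products below stay in terms of \<open>*v\<close>.\<close>

declare transpose_matrix_vector [simp del]

section \<open>Quadratic forms of symmetric matrices and the largest eigenvalue\<close>

lemma inner_matrix_vector_transpose:
  fixes B :: "real^'n^'m"
  shows "x \<bullet> (B *v y) = (transpose B *v x) \<bullet> y"
  by (metis dot_lmul_matrix transpose_matrix_vector)

text \<open>Discriminant argument for a form known to be nonnegative only on \<open>V\<close>, as
  \<open>Rayleigh_maximum_on\<close> requires. Semidefiniteness forces the separate case
  \<open>c = 0\<close>.\<close>

lemma psd_Cauchy_Schwarz_on:
  fixes P :: "real^'n^'n"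
  assumes V: "subspace V" and P: "transpose P = P"
    and psd: "\<And>x. x \<in> V \<Longrightarrow> 0 \<le> x \<bullet> (P *v x)"
    and "x \<in> V" "y \<in> V"
  shows "(x \<bullet> (P *v y))\<^sup>2 \<le> (x \<bullet> (P *v x)) * (y \<bullet> (P *v y))"
proof -
  define a b c where "a = x \<bullet> (P *v x)" and "b = x \<bullet> (P *v y)" and "c = y \<bullet> (P *v y)"
  have sym: "y \<bullet> (P *v x) = b"
    by (metis P b_def inner_commute inner_matrix_vector_transpose)
  have q: "0 \<le> s\<^sup>2 * a + 2 * s * t * b + t\<^sup>2 * c" for s t
  proof -
    have "s *\<^sub>R x + t *\<^sub>R y \<in> V"
      using assms by (simp add: subspace_add subspace_scale)
    from psd[OF this] show ?thesis
      by (simp add: matrix_vector_right_distrib matrix_vector_mult_scaleR inner_add_left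
          inner_add_right sym a_def[symmetric] b_def[symmetric] c_def[symmetric]
          algebra_simps power2_eq_square)
  qed
  have c: "0 \<le> c" using psd[OF \<open>y \<in> V\<close>] by (simp add: c_def)
  show ?thesis
  proof (cases "c = 0")
    case True
    have "b = 0"
    proof (rule ccontr)
      assume "b \<noteq> 0"
      \<comment> \<open>With \<open>c = 0\<close> the form is affine in \<open>t\<close>; this
        \<open>t\<close> gives it the value -1.\<close>
      have "0 \<le> a + 2 * (- (a + 1) / (2 * b)) * b"
        using q[of 1 "- (a + 1) / (2 * b)"] True by simp
      with \<open>b \<noteq> 0\<close> show False by (simp add: field_simps)
    qed
    with True show ?thesis by (simp add: a_def b_def c_def)
  next
    case False
    \<comment> \<open>For \<open>s = c\<close> the form is minimal at
      \<open>t = - b\<close>.\<close>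
    have "0 \<le> c * (a * c - b\<^sup>2)"
      using q[of c "- b"] by (simp add: algebra_simps power2_eq_square)
    with False c have "b\<^sup>2 \<le> a * c"
      by (simp add: zero_le_mult_iff)
    then show ?thesis by (simp add: a_def b_def c_def)
  qed
qed

text \<open>A maximiser \<open>v\<close> on the compact unit sphere of \<open>V\<close> has value
  \<open>l\<close>, so \<open>Q\<close>, which is \<open>l\<close> times the identity minus
  \<open>P\<close>, is nonnegative on \<open>V\<close> and vanishes as a form at \<open>v\<close>.
  Cauchy-Schwarz for \<open>Q *v v\<close> and \<open>v\<close> turns this into
  \<open>Q *v v = 0\<close>.\<close>

lemma Rayleigh_maximum_on:
  fixes P :: "real^'n^'n"
  assumes V: "subspace V" "V \<noteq> {0}" and P: "transpose P = P"
    and inv: "\<And>x. x \<in> V \<Longrightarrow> P *v x \<in> V"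
  obtains v l where "v \<in> V" "v \<noteq> 0" "P *v v = l *\<^sub>R v"
    and "\<And>x. x \<in> V \<Longrightarrow> x \<bullet> (P *v x) \<le> l * (norm x)\<^sup>2"
proof -
  define K where "K = V \<inter> sphere 0 1"
  obtain u where u: "u \<in> V" "u \<noteq> 0"
    using V subspace_0 by blast
  have "(1 / norm u) *\<^sub>R u \<in> K"
    using u V by (simp add: K_def subspace_scale)
  then have "K \<noteq> {}" by blast
  moreover have "compact K"
    using closed_subspace[OF V(1)] by (simp add: K_def closed_Int_compact)
  moreover have "continuous_on K (\<lambda>x. x \<bullet> (P *v x))"
    by (intro continuous_intros matrix_vector_mult_linear_continuous_on)
  ultimately obtain v where v: "v \<in> K" and max: "\<And>x. x \<in> K \<Longrightarrow> x \<bullet> (P *v x) \<le> v \<bullet> (P *v v)"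
    using continuous_attains_sup by metis
  define l where "l = v \<bullet> (P *v v)"
  have vV: "v \<in> V" "norm v = 1" using v by (auto simp: K_def)
  have le: "x \<bullet> (P *v x) \<le> l * (norm x)\<^sup>2" if x: "x \<in> V" for x
  proof (cases "x = 0")
    case False
    have "(1 / norm x) *\<^sub>R x \<in> K"
      using x False V by (simp add: K_def subspace_scale)
    from max[OF this] show ?thesis
      using False by (simp add: l_def[symmetric] matrix_vector_mult_scaleR field_simps power2_eq_square)
  qed simp
  define Q where "Q = l *\<^sub>R mat 1 - P"
  have Qv: "Q *v x = l *\<^sub>R x - P *v x" for x
    by (simp add: Q_def matrix_vector_mult_diff_rdistrib scaleR_matrix_vector_assoc[symmetric])
  have Qt: "transpose Q = Q"
    using P by (simp add: Q_def transpose_def vec_eq_iff mat_def)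
  have psd: "0 \<le> x \<bullet> (Q *v x)" if "x \<in> V" for x
    using le[OF that] by (simp add: Qv inner_diff_right power2_norm_eq_inner)
  have "v \<bullet> (Q *v v) = 0"
    using vV by (simp add: Qv inner_diff_right l_def[symmetric] power2_norm_eq_inner[symmetric])
  moreover have QvV: "Q *v v \<in> V"
    using vV inv V by (simp add: Qv subspace_diff subspace_scale)
  ultimately have "((Q *v v) \<bullet> (Q *v v))\<^sup>2 \<le> 0"
    using psd_Cauchy_Schwarz_on[OF V(1) Qt psd QvV vV(1)] by simp
  then have "Q *v v = 0" by simp
  then have "P *v v = l *\<^sub>R v" by (simp add: Qv)
  with that[of v l] vV le show thesis by (metis norm_zero zero_neq_one)
qed

text \<open>Eigenvectors of distinct eigenvalues are orthogonal, so one eigenvector per eigenvalue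
  forms an independent set. Finiteness gives \<open>Max\<close> and \<open>Min\<close> in
  \<open>lambda_max\<close> and \<open>sigma_min\<close> their intended meaning.\<close>

lemma finite_eigenvalues:
  fixes P :: "real^'n^'n"
  assumes P: "transpose P = P"
  shows "finite (eigenvalues P)"
proof -
  define f where "f l = (SOME v. v \<noteq> 0 \<and> P *v v = l *\<^sub>R v)" for l
  have f: "f l \<noteq> 0 \<and> P *v f l = l *\<^sub>R f l" if "l \<in> eigenvalues P" for l
    unfolding f_def by (rule someI_ex) (use that in \<open>auto simp: eigenvalues_def\<close>)
  have orth: "f l \<bullet> f m = 0" if "l \<in> eigenvalues P" "m \<in> eigenvalues P" "l \<noteq> m" for l m
  proof -
    have "f l \<bullet> (P *v f m) = (P *v f l) \<bullet> f m"
      using P by (simp add: inner_matrix_vector_transpose)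
    then have "m * (f l \<bullet> f m) = l * (f l \<bullet> f m)"
      using f that by simp
    with \<open>l \<noteq> m\<close> show ?thesis by simp
  qed
  have "pairwise orthogonal (f ` eigenvalues P)"
    using orth by (auto simp: pairwise_def orthogonal_def)
  moreover have "0 \<notin> f ` eigenvalues P" using f by force
  ultimately have "independent (f ` eigenvalues P)"
    by (rule pairwise_orthogonal_independent)
  then have "finite (f ` eigenvalues P)"
    by (rule independent_imp_finite)
  moreover have "inj_on f (eigenvalues P)"
    by (rule inj_onI) (metis f inner_eq_zero_iff orth)
  ultimately show ?thesis by (rule finite_imageD)
qed

lemma quadratic_form_le_lambda_max:
  fixes P :: "real^'n^'n"
  assumes P: "transpose P = P"
  shows "x \<bullet> (P *v x) \<le> lambda_max P * (norm x)\<^sup>2"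
proof -
  have "(UNIV :: (real^'n) set) \<noteq> {0}"
    by (metis UNIV_I axis_eq_0_iff singletonD zero_neq_one)
  then obtain v l where v: "v \<noteq> 0" "P *v v = l *\<^sub>R v"
    and le: "\<And>x. x \<bullet> (P *v x) \<le> l * (norm x)\<^sup>2"
    using Rayleigh_maximum_on[OF subspace_UNIV _ P] by (metis UNIV_I)
  have "l \<le> lambda_max P"
    unfolding lambda_max_def using finite_eigenvalues[OF P] v
    by (intro Max_ge) (auto simp: eigenvalues_def)
  then have "l * (norm x)\<^sup>2 \<le> lambda_max P * (norm x)\<^sup>2"
    by (simp add: mult_right_mono)
  with le[of x] show ?thesis by linarith
qed

section \<open>The smallest nonzero singular value as an expansion bound\<close>

lemma range_matrix_transpose_orthogonal:
  fixes A :: "real^'n^'m"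
  assumes "A *v x = 0" "y \<in> range ((*v) (transpose A))"
  shows "x \<bullet> y = 0"
  using assms by (auto simp: inner_matrix_vector_transpose)

lemma subspace_range_matrix: "subspace (range ((*v) (A :: real^'n^'m)))"
  by (rule linear_subspace_image[OF matrix_vector_mul_linear subspace_UNIV])

lemma range_transpose_nontrivial:
  fixes A :: "real^'n^'m"
  assumes "A \<noteq> 0"
  shows "range ((*v) (transpose A)) \<noteq> {0}"
proof
  assume "range ((*v) (transpose A)) = {0}"
  then have "transpose A *v x = 0" for x by blast
  then have "transpose A = 0" by (simp add: matrix_eq)
  then have "transpose (transpose A) = 0" by (simp add: transpose_def vec_eq_iff)
  with assms show False by simp
qed

text \<open>Maximising the form of \<open>- (transpose A ** A)\<close> over the range of the
  transpose yields the minimum \<open>- l\<close> of the squared norm of \<open>A *v x\<close> over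
  unit vectors there, attained at an eigenvector. It is positive, so its root is a nonzero singular
  value and is at least \<open>sigma_min A\<close>.\<close>

lemma sigma_min_nonneg_and_le:
  fixes A :: "real^'n^'m"
  assumes A: "A \<noteq> 0"
  shows sigma_min_nonneg: "0 \<le> sigma_min A"
    and sigma_min_le: "x \<in> range ((*v) (transpose A)) \<Longrightarrow> sigma_min A * norm x \<le> norm (A *v x)"
proof -
  let ?V = "range ((*v) (transpose A))" and ?P = "transpose A ** A"
  have quad: "x \<bullet> (?P *v x) = (norm (A *v x))\<^sup>2" for x
    by (simp add: matrix_vector_mul_assoc[symmetric] inner_matrix_vector_transpose power2_norm_eq_inner)
  have neg: "(- ?P) *v x = - (?P *v x)" for x
    by (metis matrix_vector_mult_diff_rdistrib matrix_vector_mult_0 diff_0)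
  have symP: "transpose ?P = ?P"
    by (simp add: matrix_transpose_mul)
  then have sym: "transpose (- ?P) = - ?P"
    by (simp add: transpose_def vec_eq_iff)
  have inv: "(- ?P) *v x \<in> ?V" for x
    unfolding neg using subspace_range_matrix
    by (intro subspace_neg) (auto simp: matrix_vector_mul_assoc[symmetric])
  obtain v l where v: "v \<in> ?V" "v \<noteq> 0" "(- ?P) *v v = l *\<^sub>R v"
    and le: "\<And>x. x \<in> ?V \<Longrightarrow> x \<bullet> ((- ?P) *v x) \<le> l * (norm x)\<^sup>2"
    using Rayleigh_maximum_on[OF subspace_range_matrix range_transpose_nontrivial[OF A] sym inv]
    by metis
  have ev: "?P *v v = (- l) *\<^sub>R v" using v by (simp add: neg minus_equation_iff)
  have "(norm (A *v v))\<^sup>2 = - l * (norm v)\<^sup>2"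
    unfolding quad[symmetric] ev by (simp add: power2_norm_eq_inner)
  \<comment> \<open>A vector of the range of the transpose that \<open>A\<close> annihilates would
    be orthogonal to itself.\<close>
  moreover have "A *v v \<noteq> 0"
    using range_matrix_transpose_orthogonal[of A v v] v by auto
  ultimately have l: "- l > 0"
    using v by (metis norm_eq_zero zero_less_mult_pos2 zero_less_norm_iff zero_less_power)
  have "sqrt (- l) \<in> singular_values A - {0}"
    using ev v l by (auto simp: singular_values_def eigenvalues_def intro!: imageI)
  moreover have fin: "finite (singular_values A - {0})"
    using finite_eigenvalues[OF symP] by (simp add: singular_values_def)
  ultimately have le': "sigma_min A \<le> sqrt (- l)"
    unfolding sigma_min_def by (intro Min_le)
  have "sigma_min A \<in> singular_values A - {0}"
    unfolding sigma_min_def using fin \<open>sqrt (- l) \<in> _\<close> by (intro Min_in) blast+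
  then obtain m u where m: "sigma_min A = sqrt m" "u \<noteq> 0" "?P *v u = m *\<^sub>R u"
    by (auto simp: singular_values_def eigenvalues_def)
  \<comment> \<open>\<open>sqrt\<close> is negative on negative numbers, so the sign of the
    eigenvalue \<open>m\<close> has to be established.\<close>
  then have "m * (norm u)\<^sup>2 = (norm (A *v u))\<^sup>2"
    unfolding quad[symmetric] by (simp add: power2_norm_eq_inner)
  then have "0 \<le> m * (norm u)\<^sup>2" by simp
  then have "0 \<le> m"
    using m by (simp add: zero_le_mult_iff)
  with m show nonneg: "0 \<le> sigma_min A" by simp
  assume x: "x \<in> ?V"
  have "(sigma_min A * norm x)\<^sup>2 \<le> (sqrt (- l))\<^sup>2 * (norm x)\<^sup>2"
    using le' nonneg by (simp only: power_mult_distrib) (intro mult_right_mono power_mono, auto)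
  also have "\<dots> \<le> (norm (A *v x))\<^sup>2"
    using le[OF x] l by (simp add: neg quad)
  finally show "sigma_min A * norm x \<le> norm (A *v x)"
    by (rule power2_le_imp_le) simp
qed

section \<open>Uniqueness, existence and range of the pseudoinverse\<close>

text \<open>Transposing \<open>A ** X = (A ** Y) ** (A ** X)\<close> swaps the two symmetric factors
  and so gives \<open>A ** X = A ** Y\<close>; likewise \<open>X ** A = Y ** A\<close>. Both
  equalities turn \<open>X ** A ** X\<close> into \<open>Y ** A ** Y\<close>.\<close>

lemma Penrose_unique:
  fixes A :: "real^'n^'m"
  assumes X: "A ** X ** A = A" "X ** A ** X = X"
      "transpose (A ** X) = A ** X" "transpose (X ** A) = X ** A"
    and Y: "A ** Y ** A = A" "Y ** A ** Y = Y"
      "transpose (A ** Y) = A ** Y" "transpose (Y ** A) = Y ** A"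
  shows "X = Y"
proof -
  have "A ** X = (A ** Y) ** (A ** X)"
    using Y(1) by (simp add: matrix_mul_assoc)
  then have "transpose (A ** X) = transpose (A ** X) ** transpose (A ** Y)"
    by (metis matrix_transpose_mul)
  then have 1: "A ** X = A ** Y"
    using X(1,3) Y(3) by (simp add: matrix_mul_assoc)
  have "X ** A = (X ** A) ** (Y ** A)"
    using Y(1) by (metis matrix_mul_assoc)
  then have "transpose (X ** A) = transpose (Y ** A) ** transpose (X ** A)"
    by (metis matrix_transpose_mul)
  then have 2: "X ** A = Y ** A"
    using X Y by (metis matrix_mul_assoc)
  show ?thesis
    using X(2) Y(2) 1 2 by (metis matrix_mul_assoc)
qed

text \<open>Two orthogonal decompositions: \<open>y\<close> along the range of \<open>A\<close>,
  with a rest annihilated by \<open>transpose A\<close>, then the preimage along the range of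
  \<open>transpose A\<close>, with a rest annihilated by \<open>A\<close>. The result is the
  least-squares solution of minimal norm.\<close>

lemma normal_equations_solution:
  fixes A :: "real^'n^'m"
  obtains v where "v \<in> range ((*v) (transpose A))" "transpose A *v (A *v v) = transpose A *v y"
proof -
  have split: "\<exists>v w. x = B *v v + w \<and> transpose B *v w = 0" for x :: "real^'p" and B :: "real^'q^'p"
  proof -
    have sp: "span (range ((*v) B)) = range ((*v) B)"
      using subspace_range_matrix by (rule span_eq_iff[THEN iffD2])
    obtain u w where u: "u \<in> span (range ((*v) B))"
      and w: "\<And>z. z \<in> span (range ((*v) B)) \<Longrightarrow> orthogonal w z" and x: "x = u + w"
      using orthogonal_subspace_decomp_exists[of "range ((*v) B)" x] by metis
    from u sp obtain v where v: "u = B *v v" by auto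
    have "(transpose B *v w) \<bullet> (transpose B *v w) = w \<bullet> (B *v (transpose B *v w))"
      by (simp add: inner_matrix_vector_transpose)
    also have "\<dots> = 0"
      using w sp by (auto simp: orthogonal_def)
    finally show ?thesis using v x by auto
  qed
  obtain v0 w where v0: "y = A *v v0 + w" "transpose A *v w = 0"
    using split[of y A] by auto
  obtain u n where u: "v0 = transpose A *v u + n" "A *v n = 0"
    using split[of v0 "transpose A"] by auto
  show thesis
    by (rule that[of "transpose A *v u"]) (use v0 u in \<open>auto simp: matrix_vector_right_distrib\<close>)
qed

text \<open>\<open>g\<close> sends \<open>y\<close> to its minimal least-squares solution. That
  solution is unique because \<open>A\<close> is injective on the range of its transpose; uniqueness
  makes \<open>g\<close> linear, hence given by a matrix.\<close>

lemma Penrose_exists: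
  fixes A :: "real^'n^'m"
  shows "\<exists>X. A ** X ** A = A \<and> X ** A ** X = X \<and>
     transpose (A ** X) = A ** X \<and> transpose (X ** A) = X ** A"
proof -
  let ?V = "range ((*v) (transpose A))"
  define g where "g y = (SOME v. v \<in> ?V \<and> transpose A *v (A *v v) = transpose A *v y)" for y
  have g: "g y \<in> ?V" "transpose A *v (A *v g y) = transpose A *v y" for y
    using someI_ex[of "\<lambda>v. v \<in> ?V \<and> transpose A *v (A *v v) = transpose A *v y"]
      normal_equations_solution[of A y]
    unfolding g_def by metis+
  have ker: "A *v v = 0" if "transpose A *v (A *v v) = 0" for v
    using that by (metis inner_eq_zero_iff inner_matrix_vector_transpose inner_zero_left)
  have uniq: "v = g y" if "v \<in> ?V" "transpose A *v (A *v v) = transpose A *v y" for v y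
  proof -
    have "A *v (v - g y) = 0"
      using that g by (intro ker) (simp add: matrix_vector_mult_diff_distrib)
    moreover have "v - g y \<in> ?V"
      using that g by (intro subspace_diff subspace_range_matrix)
    ultimately have "(v - g y) \<bullet> (v - g y) = 0"
      by (rule range_matrix_transpose_orthogonal)
    then show ?thesis by simp
  qed
  have lin: "linear g"
  proof (rule linearI)
    fix x y and c :: real
    show "g (x + y) = g x + g y"
      by (rule uniq[symmetric])
        (auto intro!: subspace_add subspace_range_matrix g simp: matrix_vector_right_distrib g)
    show "g (c *\<^sub>R x) = c *\<^sub>R g x"
      by (rule uniq[symmetric])
        (auto intro!: subspace_scale subspace_range_matrix g simp: matrix_vector_mult_scaleR g)
  qed
  define X where "X = matrix g"
  have X: "X *v y = g y" for y
    using lin by (simp add: X_def matrix_works)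
  have AgA: "A *v g (A *v x) = A *v x" for x
  proof -
    have "A *v (g (A *v x) - x) = 0"
      by (rule ker) (simp add: matrix_vector_mult_diff_distrib g)
    then show ?thesis by (simp add: matrix_vector_mult_diff_distrib)
  qed
  have symI: "transpose Z = Z" if "\<And>x y. (Z *v x) \<bullet> y = x \<bullet> (Z *v y)" for Z :: "real^'p^'p"
  proof -
    have "(transpose Z *v x) \<bullet> y = (Z *v x) \<bullet> y" for x y
      by (simp add: that inner_matrix_vector_transpose)
    then have "transpose Z *v x = Z *v x" for x
      by (metis vector_eq_rdot)
    then show ?thesis by (simp add: matrix_eq)
  qed
  show ?thesis
  proof (intro exI[of _ X] conjI)
    show "A ** X ** A = A"
      by (simp add: matrix_eq matrix_vector_mul_assoc[symmetric] X AgA)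
    have "g (A *v g y) = g y" for y
      using uniq[of "g y" "A *v g y"] g by simp
    then show "X ** A ** X = X"
      by (simp add: matrix_eq matrix_vector_mul_assoc[symmetric] X)
    show "transpose (A ** X) = A ** X"
    proof (rule symI)
      \<comment> \<open>After moving \<open>A\<close> to the left, the normal equations replace
        \<open>x\<close> by \<open>A *v g x\<close>. The right-hand side is symmetric in
        \<open>x\<close> and \<open>y\<close>.\<close>
      have "x \<bullet> (A *v g y) = (A *v g x) \<bullet> (A *v g y)" for x y
        by (metis g(2) inner_matrix_vector_transpose)
      then show "((A ** X) *v x) \<bullet> y = x \<bullet> ((A ** X) *v y)" for x y
        by (metis X inner_commute matrix_vector_mul_assoc)
    qed
    show "transpose (X ** A) = X ** A"
    proof (rule symI)
      have "x \<bullet> g (A *v y) = g (A *v x) \<bullet> g (A *v y)" for x y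
      proof -
        have "(x - g (A *v x)) \<bullet> g (A *v y) = 0"
          by (rule range_matrix_transpose_orthogonal[OF _ g(1)])
            (simp add: matrix_vector_mult_diff_distrib AgA)
        then show ?thesis by (simp add: inner_diff_left)
      qed
      then show "((X ** A) *v x) \<bullet> y = x \<bullet> ((X ** A) *v y)" for x y
        by (metis X inner_commute matrix_vector_mul_assoc)
    qed
  qed
qed

lemma pinv_Penrose:
  fixes A :: "real^'n^'m"
  shows "A ** pinv A ** A = A" "pinv A ** A ** pinv A = pinv A"
    "transpose (A ** pinv A) = A ** pinv A" "transpose (pinv A ** A) = pinv A ** A"
proof -
  let ?Q = "\<lambda>X. A ** X ** A = A \<and> X ** A ** X = X \<and>
     transpose (A ** X) = A ** X \<and> transpose (X ** A) = X ** A"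
  have "\<exists>!X. ?Q X"
    using Penrose_exists[of A] Penrose_unique[of A] by (intro ex_ex1I) blast+
  then have "?Q (pinv A)"
    unfolding pinv_def by (rule theI')
  then show "A ** pinv A ** A = A" "pinv A ** A ** pinv A = pinv A"
    "transpose (A ** pinv A) = A ** pinv A" "transpose (pinv A ** A) = pinv A ** A"
    by blast+
qed

text \<open>With \<open>X = pinv A\<close>, the symmetry of \<open>X ** A\<close> turns
  \<open>X ** A ** X\<close> into a product starting with \<open>transpose A\<close>.\<close>

lemma range_pinv_subset: "pinv A *v y \<in> range ((*v) (transpose (A :: real^'n^'m)))"
proof -
  have "pinv A = transpose A ** transpose (pinv A) ** pinv A"
    by (metis matrix_transpose_mul pinv_Penrose(2,4))
  then show ?thesis
    by (metis matrix_vector_mul_assoc rangeI)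
qed

text \<open>For \<open>u = A *v y\<close> with \<open>y = pinv A *v u\<close>, the squared norm of
  \<open>u\<close> is the inner product of \<open>transpose A *v u\<close> and \<open>y\<close>, and
  \<open>sigma_min_le\<close> bounds \<open>norm y\<close>. Thus the column step contracts with the
  same \<open>sigma_min A\<close>.\<close>

lemma sigma_min_transpose_le:
  fixes A :: "real^'n^'m"
  assumes A: "A \<noteq> 0" and u: "u \<in> range ((*v) A)"
  shows "sigma_min A * norm u \<le> norm (transpose A *v u)"
proof -
  obtain x where "u = A *v x" using u by blast
  define y where "y = pinv A *v u"
  have y: "u = A *v y" "y \<in> range ((*v) (transpose A))"
    using range_pinv_subset[of A u] \<open>u = A *v x\<close>
    by (simp_all add: y_def matrix_vector_mul_assoc matrix_mul_assoc pinv_Penrose)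
  have "(norm u)\<^sup>2 = (transpose A *v u) \<bullet> y"
    by (metis y(1) inner_matrix_vector_transpose power2_norm_eq_inner)
  also have "\<dots> \<le> norm (transpose A *v u) * norm y"
    by (rule norm_cauchy_schwarz)
  finally have "sigma_min A * (norm u)\<^sup>2 \<le> norm (transpose A *v u) * (sigma_min A * norm y)"
    using sigma_min_nonneg[OF A] by (metis mult.left_commute mult_left_mono)
  also have "\<dots> \<le> norm (transpose A *v u) * norm u"
    using sigma_min_le[OF A y(2)] y(1) by (simp add: mult_left_mono)
  finally show ?thesis
    by (cases "u = 0") (auto simp: power2_eq_square mult.assoc[symmetric])
qed

subsection \<open>Sampled matrices\<close>

lemma inner_mult_transpose:
  "x \<bullet> (mult_transpose S *v y) = (\<Sum>j<length S. (S ! j \<bullet> x) * (S ! j \<bullet> y))"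
proof -
  have "x \<bullet> (mult_transpose S *v y) =
      (\<Sum>i\<in>UNIV. \<Sum>l\<in>UNIV. \<Sum>j<length S. (S ! j $ i * x $ i) * (S ! j $ l * y $ l))"
    by (simp add: inner_vec_def matrix_vector_mult_def mult_transpose_def sum_distrib_left
        sum_distrib_right mult_ac)
  also have "\<dots> = (\<Sum>i\<in>UNIV. \<Sum>j<length S. \<Sum>l\<in>UNIV. (S ! j $ i * x $ i) * (S ! j $ l * y $ l))"
    by (subst sum.swap) simp
  also have "\<dots> = (\<Sum>j<length S. \<Sum>i\<in>UNIV. \<Sum>l\<in>UNIV. (S ! j $ i * x $ i) * (S ! j $ l * y $ l))"
    by (rule sum.swap)
  also have "\<dots> = (\<Sum>j<length S. (S ! j \<bullet> x) * (S ! j \<bullet> y))"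
    by (simp add: inner_vec_def sum_product)
  finally show ?thesis .
qed

lemma mult_transpose_psd: "0 \<le> x \<bullet> (mult_transpose S *v x)"
  by (simp add: inner_mult_transpose sum_nonneg)

lemma transpose_mult_transpose: "transpose (mult_transpose S) = mult_transpose S"
  by (simp add: mult_transpose_def transpose_def vec_eq_iff mult.commute)

text \<open>The square of \<open>norm c\<close> is the form of \<open>mult_transpose S\<close> at
  \<open>B *v c\<close> and \<open>w\<close>. Cauchy-Schwarz and the eigenvalue bound at
  \<open>c\<close> estimate its square by \<open>l * (norm c)\<^sup>2\<close> times the form at
  \<open>w\<close>; one factor cancels.\<close>

lemma norm_sampled_le:
  fixes B :: "real^'n^'m"
  assumes l: "lambda_max (transpose B ** mult_transpose S ** B) \<le> l" and "0 \<le> l"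
  shows "(norm (transpose B *v (mult_transpose S *v w)))\<^sup>2 \<le> l * (w \<bullet> (mult_transpose S *v w))"
proof -
  let ?G = "mult_transpose S" and ?W = "transpose B ** mult_transpose S ** B"
  define c where "c = transpose B *v (?G *v w)"
  have "(norm c)\<^sup>2 = (B *v c) \<bullet> (?G *v w)"
    by (metis c_def inner_commute inner_matrix_vector_transpose power2_norm_eq_inner)
  then have "((norm c)\<^sup>2)\<^sup>2 \<le> ((B *v c) \<bullet> (?G *v (B *v c))) * (w \<bullet> (?G *v w))"
    using psd_Cauchy_Schwarz_on[OF subspace_UNIV transpose_mult_transpose mult_transpose_psd]
    by simp
  also have "(B *v c) \<bullet> (?G *v (B *v c)) = c \<bullet> (?W *v c)"
    by (simp add: inner_matrix_vector_transpose matrix_vector_mul_assoc[symmetric])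
  also have "\<dots> * (w \<bullet> (?G *v w)) \<le> (l * (norm c)\<^sup>2) * (w \<bullet> (?G *v w))"
  proof (rule mult_right_mono[OF _ mult_transpose_psd])
    have "transpose ?W = ?W"
      by (simp add: matrix_transpose_mul transpose_mult_transpose matrix_mul_assoc)
    from quadratic_form_le_lambda_max[OF this, of c] l
    show "c \<bullet> (?W *v c) \<le> l * (norm c)\<^sup>2"
      by (meson mult_right_mono order_trans zero_le_power2)
  qed
  finally have le: "(norm c)\<^sup>2 * (norm c)\<^sup>2 \<le> (l * (w \<bullet> (?G *v w))) * (norm c)\<^sup>2"
    by (simp add: power2_eq_square mult_ac)
  have "(norm c)\<^sup>2 \<le> l * (w \<bullet> (?G *v w))"
  proof (cases "c = 0")
    case True
    then show ?thesis using \<open>0 \<le> l\<close> mult_transpose_psd[of w S] by simp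
  next
    case False
    then show ?thesis by (intro mult_right_le_imp_le[OF le]) simp
  qed
  then show ?thesis by (simp add: c_def)
qed

section \<open>The support of a sampling distribution\<close>

lemma box_in_block_borel:
  fixes S :: "'m::finite block"
  shows "{S'. length S' = length S \<and> (\<forall>j<length S. dist (S' ! j) (S ! j) < e)} \<in> sets block_borel"
proof -
  have "{S'. length S' = length S \<and> (\<forall>j<length S. dist (S' ! j) (S ! j) < e)} =
      {S'. length S' = length S \<and> (\<forall>j<length S. S' ! j \<in> ball (S ! j) e)}"
    by (simp add: dist_commute)
  also have "\<dots> \<in> sets block_borel"
    unfolding block_borel_def
    by (subst sets_measure_of) (auto intro!: sigma_sets.Basic exI[of _ "\<lambda>j. ball (S ! j) e"] exI[of _ "length S"])
  finally show ?thesis .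
qed

lemma space_block_borel [simp]: "space block_borel = UNIV"
  by (simp add: block_borel_def space_measure_of_conv)

text \<open>The space of blocks is second countable, so the complement of the support is covered by
  countably many null neighbourhoods.\<close>

lemma AE_realizations:
  fixes D :: "'m::finite block measure"
  assumes "finite_measure D" and sets: "sets D = sets block_borel"
  shows "AE S in D. S \<in> realizations D"
proof -
  interpret finite_measure D by fact
  define nbhd where "nbhd S e = {S'. length S' = length S \<and> (\<forall>j<length S. dist (S' ! j) (S ! j) < e)}"
    for S :: "'m block" and e :: real
  have meas: "nbhd S e \<in> sets D" for S e
    unfolding nbhd_def sets by (rule box_in_block_borel)
  obtain Q :: "(real^'m) set" where Q: "countable Q"
    and dense: "\<And>U. open U \<Longrightarrow> U \<noteq> {} \<Longrightarrow> \<exists>q\<in>Q. q \<in> U"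
    using countable_dense_setE by blast
  \<comment> \<open>Only null neighbourhoods with columns of the centre in \<open>Q\<close> and
    radius \<open>1 / Suc n\<close> are collected, which keeps \<open>I\<close> countable.\<close>
  define I where "I = {(L, n) \<in> lists Q \<times> (UNIV :: nat set). measure D (nbhd L (1 / Suc n)) = 0}"
  define N where "N = (\<Union>(L, n)\<in>I. nbhd L (1 / Suc n))"
  have "countable I"
    by (rule countable_subset[of _ "lists Q \<times> UNIV"]) (auto simp: I_def Q)
  then have "N \<in> null_sets D"
    unfolding N_def by (intro null_sets_UN')
      (auto simp: I_def meas null_sets_def emeasure_eq_measure)
  moreover have "S \<in> N" if "S \<notin> realizations D" for S
  proof -
    have "\<not> (\<forall>e>0. 0 < measure D (nbhd S e))"
      using that by (simp add: realizations_def nbhd_def)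
    then obtain e where "e > 0" "\<not> 0 < measure D (nbhd S e)" by blast
    then have e: "e > 0" "measure D (nbhd S e) = 0"
      using measure_nonneg[of D "nbhd S e"] by linarith+
    \<comment> \<open>One radius separates the column from its approximation in \<open>Q\<close>,
      another the approximation from a point of the small neighbourhood; together they must stay
      below \<open>e\<close>.\<close>
    obtain n where n: "1 / Suc n < e / 2"
      using reals_Archimedean[of "e / 2"] e by (auto simp: inverse_eq_divide)
    have "\<exists>q\<in>Q. dist x q < 1 / Suc n" for x
      using dense[of "ball x (1 / Suc n)"] by auto
    then obtain q where q: "\<And>x. q x \<in> Q" "\<And>x. dist x (q x) < 1 / Suc n" by metis
    define L where "L = map q S"
    have "nbhd L (1 / Suc n) \<subseteq> nbhd S e"
    proof
      fix S' assume "S' \<in> nbhd L (1 / Suc n)"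
      then have S': "length S' = length S" "\<And>j. j < length S \<Longrightarrow> dist (S' ! j) (q (S ! j)) < 1 / Suc n"
        by (auto simp: nbhd_def L_def)
      have "dist (S' ! j) (S ! j) < e" if "j < length S" for j
        using S'(2)[OF that] q(2)[of "S ! j"] n dist_triangle2[of "S' ! j" "S ! j" "q (S ! j)"]
        by linarith
      with S' show "S' \<in> nbhd S e" by (simp add: nbhd_def)
    qed
    then have "measure D (nbhd L (1 / Suc n)) \<le> measure D (nbhd S e)"
      by (intro finite_measure_mono meas)
    with e have "measure D (nbhd L (1 / Suc n)) = 0"
      using measure_nonneg[of D "nbhd L (1 / Suc n)"] by linarith
    then have "(L, n) \<in> I"
      using q by (auto simp: I_def L_def)
    moreover have "S \<in> nbhd L (1 / Suc n)"
      using q by (simp add: nbhd_def L_def)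
    ultimately show ?thesis by (auto simp: N_def)
  qed
  ultimately show ?thesis
    by (intro AE_I'[of N]) auto
qed

section \<open>Tools for averaging over one sample\<close>

text \<open>The form is linear in the matrix, so the expectation passes through it; here the
  normalisation of the sampling distribution enters.\<close>

lemma expectation_quadratic_form:
  fixes D :: "'m::finite block measure"
  assumes "sampling_distribution D"
  shows "has_bochner_integral D (\<lambda>S. x \<bullet> (mult_transpose S *v x)) ((norm x)\<^sup>2)"
proof -
  have "linear (\<lambda>G :: real^'m^'m. x \<bullet> (G *v x))"
    by (rule linearI)
      (simp_all add: matrix_vector_mult_add_rdistrib scaleR_matrix_vector_assoc[symmetric] inner_add_right)
  then have "bounded_linear (\<lambda>G :: real^'m^'m. x \<bullet> (G *v x))"
    by (simp add: linear_conv_bounded_linear)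
  moreover have "has_bochner_integral D mult_transpose (mat 1)"
    using assms by (simp add: sampling_distribution_def)
  ultimately have "has_bochner_integral D (\<lambda>S. x \<bullet> (mult_transpose S *v x)) (x \<bullet> (mat 1 *v x))"
    by (rule has_bochner_integral_bounded_linear)
  then show ?thesis by (simp add: power2_norm_eq_inner)
qed

text \<open>An almost sure majorant transfers by monotonicity of the extended integral. The sign of
  \<open>I\<close> is recorded because nonnegativity of \<open>eta\<close> is derived from
  it.\<close>

lemma nn_integral_le_has_bochner_integral:
  fixes f g :: "'a \<Rightarrow> real"
  assumes g: "has_bochner_integral M g I" and le: "AE x in M. f x \<le> g x" and f: "\<And>x. 0 \<le> f x"
  shows "(\<integral>\<^sup>+x. ennreal (f x) \<partial>M) \<le> ennreal I" and "0 \<le> I"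
proof -
  have g0: "AE x in M. 0 \<le> g x"
    using le by eventually_elim (use f in \<open>blast intro: order_trans\<close>)
  have "(\<integral>\<^sup>+x. ennreal (f x) \<partial>M) \<le> (\<integral>\<^sup>+x. ennreal (g x) \<partial>M)"
    by (rule nn_integral_mono_AE) (use le in \<open>auto intro: ennreal_leI\<close>)
  also have "\<dots> = ennreal I"
    using g g0 by (simp add: nn_integral_eq_integral has_bochner_integral_iff)
  finally show "(\<integral>\<^sup>+x. ennreal (f x) \<partial>M) \<le> ennreal I" .
  show "0 \<le> I"
    using g g0 integral_nonneg_AE[of g M] by (simp add: has_bochner_integral_iff)
qed

text \<open>Young's inequality, from the square of \<open>e *\<^sub>R a + c\<close>;
  \<open>e\<close> becomes the free parameter \<open>eps\<close> of the final bound.\<close>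

lemma norm_diff_square_le:
  fixes a c :: "'a::real_inner"
  assumes "0 < e"
  shows "(norm (a - c))\<^sup>2 \<le> (1 + e) * (norm a)\<^sup>2 + (1 + 1 / e) * (norm c)\<^sup>2"
proof -
  have "0 \<le> (norm (e *\<^sub>R a + c))\<^sup>2 / e"
    using assms by simp
  also have "\<dots> = e * (norm a)\<^sup>2 + 2 * (a \<bullet> c) + (norm c)\<^sup>2 / e"
    using assms by (simp add: power2_norm_eq_inner inner_add_left inner_add_right inner_commute field_simps)
  finally have "(norm a)\<^sup>2 - 2 * (a \<bullet> c) + (norm c)\<^sup>2
      \<le> (1 + e) * (norm a)\<^sup>2 + (1 + 1 / e) * (norm c)\<^sup>2"
    by (simp add: algebra_simps)
  then show ?thesis
    by (simp add: power2_norm_eq_inner inner_diff_left inner_diff_right inner_commute algebra_simps)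
qed

section \<open>One random step for a generic matrix \<open>B\<close>: later \<open>A\<close> for
  rows and its transpose for columns\<close>

context
  fixes B :: "real^'n^'m" and D :: "'m::finite block measure" and l \<alpha> :: real
  assumes D: "sampling_distribution D" and l: "is_maximum (lambda_values_r B D) l"
    and \<alpha>: "0 < \<alpha>" "\<alpha> < 2 / l"
begin

lemma maximum_pos: "0 < l" and stepsize_pos: "0 < \<alpha> * (2 - \<alpha> * l)"
proof -
  \<comment> \<open>Since \<open>2 / 0 = 0\<close>, a positive stepsize below \<open>2 / l\<close>
    also excludes \<open>l = 0\<close>.\<close>
  have "0 < 2 / l" using \<alpha> by linarith
  then show "0 < l" by (simp add: zero_less_divide_iff)
  with \<alpha> show "0 < \<alpha> * (2 - \<alpha> * l)" by (simp add: field_simps)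
qed

text \<open>The quantifier over \<open>w\<close> stands inside, so one null set serves all vectors,
  in particular both vectors of the perturbed step.\<close>

lemma AE_norm_sampled_le:
  "AE S in D. \<forall>w. (norm (transpose B *v (mult_transpose S *v w)))\<^sup>2 \<le> l * (w \<bullet> (mult_transpose S *v w))"
proof -
  have "AE S in D. S \<in> realizations D"
    using D by (intro AE_realizations)
      (auto simp: sampling_distribution_def prob_space_def)
  then show ?thesis
  proof eventually_elim
    case (elim S)
    then have "lambda_max (transpose B ** mult_transpose S ** B) \<le> l"
      using l by (auto simp: is_maximum_def lambda_values_r_def)
    then show ?case
      using maximum_pos by (intro allI norm_sampled_le) auto
  qed
qed

text \<open>In the expanded square, the cross term is a multiple of the form \<open>q\<close>, and
  the assumption bounds the quadratic term by a multiple of the same \<open>q\<close>.\<close>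

lemma norm_step_le:
  assumes "\<forall>w. (norm (transpose B *v (mult_transpose S *v w)))\<^sup>2 \<le> l * (w \<bullet> (mult_transpose S *v w))"
  shows "(norm (v - \<alpha> *\<^sub>R (transpose B *v (mult_transpose S *v (B *v v)))))\<^sup>2
    \<le> (norm v)\<^sup>2 - \<alpha> * (2 - \<alpha> * l) * ((B *v v) \<bullet> (mult_transpose S *v (B *v v)))"
proof -
  define q where "q = (B *v v) \<bullet> (mult_transpose S *v (B *v v))"
  define c where "c = transpose B *v (mult_transpose S *v (B *v v))"
  have "v \<bullet> c = q"
    by (metis c_def q_def inner_commute inner_matrix_vector_transpose)
  then have "(norm (v - \<alpha> *\<^sub>R c))\<^sup>2 = (norm v)\<^sup>2 - 2 * \<alpha> * q + \<alpha>\<^sup>2 * (norm c)\<^sup>2"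
    by (simp add: power2_norm_eq_inner inner_diff_left inner_diff_right inner_commute
        power2_eq_square[of \<alpha>] algebra_simps)
  also have "\<dots> \<le> (norm v)\<^sup>2 - 2 * \<alpha> * q + \<alpha>\<^sup>2 * (l * q)"
    using assms by (auto simp: c_def q_def intro!: mult_left_mono)
  also have "\<dots> = (norm v)\<^sup>2 - \<alpha> * (2 - \<alpha> * l) * q"
    by (simp add: power2_eq_square algebra_simps)
  finally show ?thesis by (simp add: c_def q_def)
qed

lemma expected_decrease:
  "has_bochner_integral D
     (\<lambda>S. (norm v)\<^sup>2 - \<alpha> * (2 - \<alpha> * l) * ((B *v v) \<bullet> (mult_transpose S *v (B *v v))))
     ((norm v)\<^sup>2 - \<alpha> * (2 - \<alpha> * l) * (norm (B *v v))\<^sup>2)"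
proof -
  interpret prob_space D using D by (simp add: sampling_distribution_def)
  have "has_bochner_integral D (\<lambda>S. (norm v)\<^sup>2) ((norm v)\<^sup>2)"
    by (simp add: has_bochner_integral_iff prob_space)
  then show ?thesis
    by (intro has_bochner_integral_diff has_bochner_integral_mult_right expectation_quadratic_form D)
qed

lemma decrease_le:
  assumes s: "0 \<le> s" "s * norm v \<le> norm (B *v v)"
  shows "(norm v)\<^sup>2 - \<alpha> * (2 - \<alpha> * l) * (norm (B *v v))\<^sup>2
    \<le> (1 - \<alpha> * (2 - \<alpha> * l) * s\<^sup>2) * (norm v)\<^sup>2"
proof -
  have "(s * norm v)\<^sup>2 \<le> (norm (B *v v))\<^sup>2"
    using s by (intro power_mono) auto
  then have "\<alpha> * (2 - \<alpha> * l) * (s\<^sup>2 * (norm v)\<^sup>2) \<le> \<alpha> * (2 - \<alpha> * l) * (norm (B *v v))\<^sup>2"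
    using stepsize_pos by (intro mult_left_mono) (auto simp: power_mult_distrib)
  then show ?thesis by (simp add: algebra_simps)
qed

text \<open>Averaging turns the form in \<open>norm_step_le\<close> into the squared norm of
  \<open>B *v v\<close>, which \<open>s\<close> bounds from below. The second conclusion holds
  because a bound for averaged squares is nonnegative.\<close>

lemma contraction_in_expectation:
  assumes s: "0 \<le> s" "s * norm v \<le> norm (B *v v)"
  shows "(\<integral>\<^sup>+S. ennreal ((norm (v - \<alpha> *\<^sub>R (transpose B *v (mult_transpose S *v (B *v v)))))\<^sup>2) \<partial>D)
      \<le> ennreal ((1 - \<alpha> * (2 - \<alpha> * l) * s\<^sup>2) * (norm v)\<^sup>2)"
    and contraction_factor_nonneg: "0 \<le> (1 - \<alpha> * (2 - \<alpha> * l) * s\<^sup>2) * (norm v)\<^sup>2"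
proof -
  have le: "AE S in D. (norm (v - \<alpha> *\<^sub>R (transpose B *v (mult_transpose S *v (B *v v)))))\<^sup>2
     \<le> (norm v)\<^sup>2 - \<alpha> * (2 - \<alpha> * l) * ((B *v v) \<bullet> (mult_transpose S *v (B *v v)))"
    using AE_norm_sampled_le by eventually_elim (rule norm_step_le)
  note I = nn_integral_le_has_bochner_integral[OF expected_decrease le]
  show "(\<integral>\<^sup>+S. ennreal ((norm (v - \<alpha> *\<^sub>R (transpose B *v (mult_transpose S *v (B *v v)))))\<^sup>2) \<partial>D)
      \<le> ennreal ((1 - \<alpha> * (2 - \<alpha> * l) * s\<^sup>2) * (norm v)\<^sup>2)"
    using I(1) decrease_le[OF s] by (simp add: order_trans[OF _ ennreal_leI])
  show "0 \<le> (1 - \<alpha> * (2 - \<alpha> * l) * s\<^sup>2) * (norm v)\<^sup>2"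
    using I(2) decrease_le[OF s] by simp
qed

text \<open>\<open>norm_diff_square_le\<close> separates the contracting unperturbed step from the
  noise due to \<open>w\<close>. Both are bounded by expressions affine in
  \<open>mult_transpose S\<close>, which can be averaged.\<close>

lemma perturbed_contraction_in_expectation:
  assumes s: "0 \<le> s" "s * norm v \<le> norm (B *v v)" and e: "0 < e"
  shows "(\<integral>\<^sup>+S. ennreal ((norm (v - \<alpha> *\<^sub>R (transpose B *v (mult_transpose S *v (B *v v + w)))))\<^sup>2) \<partial>D)
      \<le> ennreal ((1 + e) * ((1 - \<alpha> * (2 - \<alpha> * l) * s\<^sup>2) * (norm v)\<^sup>2)
          + (1 + 1 / e) * (\<alpha>\<^sup>2 * (l * (norm w)\<^sup>2)))"
proof -
  let ?c = "\<lambda>S y. \<alpha> *\<^sub>R (transpose B *v (mult_transpose S *v y))"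
  let ?g = "\<lambda>S. (1 + e) * ((norm v)\<^sup>2 - \<alpha> * (2 - \<alpha> * l) * ((B *v v) \<bullet> (mult_transpose S *v (B *v v))))
      + (1 + 1 / e) * (\<alpha>\<^sup>2 * (l * (w \<bullet> (mult_transpose S *v w))))"
  have int: "has_bochner_integral D ?g
      ((1 + e) * ((norm v)\<^sup>2 - \<alpha> * (2 - \<alpha> * l) * (norm (B *v v))\<^sup>2) + (1 + 1 / e) * (\<alpha>\<^sup>2 * (l * (norm w)\<^sup>2)))"
    by (intro has_bochner_integral_add has_bochner_integral_mult_right expected_decrease
        expectation_quadratic_form D)
  have "AE S in D. (norm (v - ?c S (B *v v + w)))\<^sup>2 \<le> ?g S"
    using AE_norm_sampled_le
  proof eventually_elim
    case (elim S)
    have "(norm (v - ?c S (B *v v + w)))\<^sup>2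
        \<le> (1 + e) * (norm (v - ?c S (B *v v)))\<^sup>2 + (1 + 1 / e) * (norm (?c S w))\<^sup>2"
      using norm_diff_square_le[OF e, of "v - ?c S (B *v v)" "?c S w"]
      by (simp add: matrix_vector_right_distrib scaleR_add_right diff_diff_eq)
    also have "\<dots> \<le> ?g S"
    proof (intro add_mono mult_left_mono)
      show "(norm (?c S w))\<^sup>2 \<le> \<alpha>\<^sup>2 * (l * (w \<bullet> (mult_transpose S *v w)))"
        using elim by (simp add: power_mult_distrib mult_left_mono)
    qed (use norm_step_le[OF elim] e in auto)
    finally show ?case .
  qed
  then have "(\<integral>\<^sup>+S. ennreal ((norm (v - ?c S (B *v v + w)))\<^sup>2) \<partial>D)
      \<le> ennreal ((1 + e) * ((norm v)\<^sup>2 - \<alpha> * (2 - \<alpha> * l) * (norm (B *v v))\<^sup>2)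
        + (1 + 1 / e) * (\<alpha>\<^sup>2 * (l * (norm w)\<^sup>2)))"
    by (rule nn_integral_le_has_bochner_integral(1)[OF int]) simp
  also have "\<dots> \<le> ennreal ((1 + e) * ((1 - \<alpha> * (2 - \<alpha> * l) * s\<^sup>2) * (norm v)\<^sup>2)
          + (1 + 1 / e) * (\<alpha>\<^sup>2 * (l * (norm w)\<^sup>2)))"
    using e by (intro ennreal_leI add_right_mono mult_left_mono decrease_le[OF s]) auto
  finally show ?thesis .
qed

end

subsection \<open>The EBRSI iteration\<close>

lemma borel_measurable_matrix_vector_mult [measurable (raw)]:
  fixes G :: "'a \<Rightarrow> real^'n^'m"
  assumes "G \<in> borel_measurable M" "v \<in> borel_measurable M"
  shows "(\<lambda>x. G x *v v x) \<in> borel_measurable M"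
  using assms
  by (rule borel_measurable_continuous_Pair)
    (simp add: matrix_vector_mult_def, intro continuous_intros continuous_on_vec_lambda)

text \<open>Iterate \<open>k\<close> reads samples 1 to \<open>k\<close> only, so a path may be
  restricted to them or altered at \<open>Suc k\<close>.\<close>

lemma ebrsi_z_cong:
  assumes "\<And>j. 1 \<le> j \<Longrightarrow> j \<le> k \<Longrightarrow> T j = T' j"
  shows "ebrsi_z A ac z0 T k = ebrsi_z A ac z0 T' k"
  using assms by (induction k) auto

lemma ebrsi_x_cong:
  assumes "\<And>j. 1 \<le> j \<Longrightarrow> j \<le> k \<Longrightarrow> T j = T' j" "\<And>j. 1 \<le> j \<Longrightarrow> j \<le> k \<Longrightarrow> S j = S' j"
  shows "ebrsi_x A b ac ar z0 x0 T S k = ebrsi_x A b ac ar z0 x0 T' S' k"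
  using assms
proof (induction k)
  case (Suc k)
  have "ebrsi_z A ac z0 T (Suc k) = ebrsi_z A ac z0 T' (Suc k)"
    by (intro ebrsi_z_cong Suc.prems)
  with Suc show ?case by (simp del: ebrsi_z.simps)
qed simp

lemma borel_measurable_ebrsi_z:
  assumes "\<And>j. 1 \<le> j \<Longrightarrow> j \<le> k \<Longrightarrow> (\<lambda>\<omega>. mult_transpose (T \<omega> j)) \<in> borel_measurable M"
  shows "(\<lambda>\<omega>. ebrsi_z A ac z0 (T \<omega>) k) \<in> borel_measurable M"
  using assms
proof (induction k)
  case (Suc k)
  have [measurable]: "(\<lambda>\<omega>. ebrsi_z A ac z0 (T \<omega>) k) \<in> borel_measurable M"
    "(\<lambda>\<omega>. mult_transpose (T \<omega> (Suc k))) \<in> borel_measurable M"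
    using Suc by auto
  show ?case
    by (simp add: matrix_vector_mul_assoc[symmetric])
qed simp

lemma borel_measurable_ebrsi_x:
  assumes "\<And>j. 1 \<le> j \<Longrightarrow> j \<le> k \<Longrightarrow> (\<lambda>\<omega>. mult_transpose (T \<omega> j)) \<in> borel_measurable M"
    and "\<And>j. 1 \<le> j \<Longrightarrow> j \<le> k \<Longrightarrow> (\<lambda>\<omega>. mult_transpose (S \<omega> j)) \<in> borel_measurable M"
  shows "(\<lambda>\<omega>. ebrsi_x A b ac ar z0 x0 (T \<omega>) (S \<omega>) k) \<in> borel_measurable M"
  using assms
proof (induction k)
  case (Suc k)
  have [measurable]: "(\<lambda>\<omega>. ebrsi_x A b ac ar z0 x0 (T \<omega>) (S \<omega>) k) \<in> borel_measurable M"
    "(\<lambda>\<omega>. mult_transpose (S \<omega> (Suc k))) \<in> borel_measurable M"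
    using Suc by auto
  have [measurable]: "(\<lambda>\<omega>. ebrsi_z A ac z0 (T \<omega>) (Suc k)) \<in> borel_measurable M"
    by (intro borel_measurable_ebrsi_z Suc.prems)
  show ?case
    by (simp add: matrix_vector_mul_assoc[symmetric] del: ebrsi_z.simps)
qed simp

text \<open>Having an expectation includes measurability, and \<open>D\<close> has the measurable
  sets of \<open>block_borel\<close>.\<close>

lemma borel_measurable_mult_transpose:
  fixes D :: "'m::finite block measure"
  assumes "sampling_distribution D"
  shows "(mult_transpose :: 'm block \<Rightarrow> _) \<in> borel_measurable block_borel"
proof -
  have D: "mult_transpose \<in> borel_measurable D" and sets: "sets D = sets block_borel"
    using assms by (auto simp: sampling_distribution_def has_bochner_integral_iff)
  show ?thesis
    using D unfolding measurable_cong_sets[OF sets refl] .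
qed

section \<open>Error recursions and invariant ranges\<close>

text \<open>\<open>z\<close> is the least-squares residual of \<open>b\<close>, orthogonal to the
  range of \<open>A\<close>; hence \<open>transpose A *v z = 0\<close> and the update fixes
  \<open>z\<close>.\<close>

lemma ebrsi_z_error_Suc:
  fixes A :: "real^'n^'m" and b z0 :: "real^'m"
  defines "z \<equiv> (mat 1 - A ** pinv A) *v b"
  shows "ebrsi_z A ac z0 T (Suc k) - z = (ebrsi_z A ac z0 T k - z)
    - ac *\<^sub>R (A *v (mult_transpose (T (Suc k)) *v (transpose A *v (ebrsi_z A ac z0 T k - z))))"
proof -
  have "transpose A ** (A ** pinv A) = transpose A"
    by (metis matrix_transpose_mul pinv_Penrose(1,3))
  then have "transpose A *v z = 0"
    by (simp add: z_def matrix_vector_mult_diff_rdistrib matrix_vector_mult_diff_distrib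
        matrix_vector_mul_assoc)
  then show ?thesis
    by (simp add: matrix_vector_mult_diff_distrib matrix_vector_mul_assoc[symmetric])
qed

lemma ebrsi_z_error_in_range:
  fixes A :: "real^'n^'m"
  assumes "z0 \<in> (+) b ` range ((*v) A)"
  shows "ebrsi_z A ac z0 T k - (mat 1 - A ** pinv A) *v b \<in> range ((*v) A)"
proof (induction k)
  case 0
  obtain y where "z0 = b + A *v y" using assms by auto
  then have "ebrsi_z A ac z0 T 0 - (mat 1 - A ** pinv A) *v b = A *v (y + pinv A *v b)"
    by (simp add: matrix_vector_mult_diff_rdistrib matrix_vector_right_distrib matrix_vector_mul_assoc[symmetric])
  then show ?case by blast
next
  case (Suc k)
  then show ?case
    unfolding ebrsi_z_error_Suc
    by (intro subspace_diff[OF subspace_range_matrix _ subspace_scale[OF subspace_range_matrix rangeI]])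
qed

text \<open>\<open>A\<close> annihilates the part of \<open>x_star\<close> coming from
  \<open>x0\<close> and maps the rest to \<open>b\<close> minus the limit of the \<open>z\<close>
  iterates, so the vector driving the update splits into the two errors.\<close>

lemma ebrsi_x_error_Suc:
  fixes A :: "real^'n^'m"
  shows "ebrsi_x A b ac ar z0 x0 T S (Suc k) - x_star A b x0 =
    (ebrsi_x A b ac ar z0 x0 T S k - x_star A b x0)
    - ar *\<^sub>R (transpose A *v (mult_transpose (S (Suc k)) *v
        (A *v (ebrsi_x A b ac ar z0 x0 T S k - x_star A b x0)
         + (ebrsi_z A ac z0 T (Suc k) - (mat 1 - A ** pinv A) *v b))))"
proof -
  have "A *v x_star A b x0 = A *v (pinv A *v b)"
    by (simp add: x_star_def matrix_vector_right_distrib matrix_vector_mult_diff_rdistrib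
        matrix_vector_mult_diff_distrib matrix_vector_mul_assoc matrix_mul_assoc pinv_Penrose)
  then have *: "A *v (ebrsi_x A b ac ar z0 x0 T S k - x_star A b x0)
         + (ebrsi_z A ac z0 T (Suc k) - (mat 1 - A ** pinv A) *v b)
       = A *v ebrsi_x A b ac ar z0 x0 T S k - b + ebrsi_z A ac z0 T (Suc k)"
    by (simp add: matrix_vector_mult_diff_rdistrib matrix_vector_mult_diff_distrib
        matrix_vector_mul_assoc[symmetric] del: ebrsi_z.simps)
  show ?thesis
    unfolding * by (simp add: matrix_vector_mul_assoc[symmetric] del: ebrsi_z.simps)
qed

text \<open>The kernel component of \<open>x0\<close> cancels against the one built into
  \<open>x_star\<close>, leaving an initial error in the range of \<open>pinv A\<close>. Updates
  subtract vectors of the range of \<open>transpose A\<close>.\<close>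

lemma ebrsi_x_error_in_range:
  fixes A :: "real^'n^'m"
  shows "ebrsi_x A b ac ar z0 x0 T S k - x_star A b x0 \<in> range ((*v) (transpose A))"
proof (induction k)
  case 0
  have "ebrsi_x A b ac ar z0 x0 T S 0 - x_star A b x0 = pinv A *v (A *v x0 - b)"
    by (simp add: x_star_def matrix_vector_mult_diff_rdistrib matrix_vector_mult_diff_distrib
        matrix_vector_mul_assoc[symmetric])
  then show ?case using range_pinv_subset by metis
next
  case (Suc k)
  then show ?case
    unfolding ebrsi_x_error_Suc
    by (intro subspace_diff[OF subspace_range_matrix _ subspace_scale[OF subspace_range_matrix rangeI]])
qed

section \<open>The joint law of the samples\<close>

text \<open>Independence within a pair gives the product formula on rectangles, which determines the
  product measure.\<close>

lemma distr_ebrsi_sample: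
  assumes M: "prob_space M" and samples: "ebrsi_samples M Dr Dc S T" and k: "1 \<le> k"
  shows "distr M (block_borel \<Otimes>\<^sub>M block_borel) (\<lambda>\<omega>. (S k \<omega>, T k \<omega>)) = Dr \<Otimes>\<^sub>M Dc"
proof -
  interpret prob_space M by fact
  have [measurable]: "S k \<in> measurable M block_borel" "T k \<in> measurable M block_borel"
    and Dr: "distr M block_borel (S k) = Dr" and Dc: "distr M block_borel (T k) = Dc"
    and indep: "indep_set {S k -` X \<inter> space M |X. X \<in> sets block_borel}
              {T k -` Y \<inter> space M |Y. Y \<in> sets block_borel}"
    using samples k by (auto simp: ebrsi_samples_def)
  have prob: "prob_space Dr" "prob_space Dc"
    unfolding Dr[symmetric] Dc[symmetric] by (auto intro!: prob_space_distr)
  have sets: "sets Dr = sets block_borel" "sets Dc = sets block_borel"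
    unfolding Dr[symmetric] Dc[symmetric] by simp_all
  show ?thesis
  proof (rule pair_measure_eqI[symmetric])
    show "sigma_finite_measure Dr" "sigma_finite_measure Dc"
      using prob by (auto simp: prob_space_imp_sigma_finite)
    show "sets (Dr \<Otimes>\<^sub>M Dc) = sets (distr M (block_borel \<Otimes>\<^sub>M block_borel) (\<lambda>\<omega>. (S k \<omega>, T k \<omega>)))"
      using sets by (simp cong: sets_pair_measure_cong)
    fix X Y assume "X \<in> sets Dr" "Y \<in> sets Dc"
    then have [measurable]: "X \<in> sets block_borel" "Y \<in> sets block_borel"
      using sets by auto
    have "prob ((S k -` X \<inter> space M) \<inter> (T k -` Y \<inter> space M))
        = prob (S k -` X \<inter> space M) * prob (T k -` Y \<inter> space M)"
      by (rule indep_setD[OF indep]) (auto intro: exI[of _ X] exI[of _ Y])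
    moreover have "(\<lambda>\<omega>. (S k \<omega>, T k \<omega>)) -` (X \<times> Y) \<inter> space M
        = (S k -` X \<inter> space M) \<inter> (T k -` Y \<inter> space M)"
      by auto
    ultimately show "emeasure Dr X * emeasure Dc Y
        = emeasure (distr M (block_borel \<Otimes>\<^sub>M block_borel) (\<lambda>\<omega>. (S k \<omega>, T k \<omega>))) (X \<times> Y)"
      unfolding Dr[symmetric] Dc[symmetric]
      by (simp add: emeasure_distr emeasure_eq_measure ennreal_mult)
  qed
qed

lemma distr_ebrsi_samples:
  assumes M: "prob_space M" and samples: "ebrsi_samples M Dr Dc S T" and k: "1 \<le> k"
  shows "distr M (\<Pi>\<^sub>M i\<in>{1..k}. block_borel \<Otimes>\<^sub>M block_borel) (\<lambda>\<omega>. \<lambda>i\<in>{1..k}. (S i \<omega>, T i \<omega>))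
    = (\<Pi>\<^sub>M i\<in>{1..k}. Dr \<Otimes>\<^sub>M Dc)"
proof -
  interpret prob_space M by fact
  have "indep_vars (\<lambda>_. block_borel \<Otimes>\<^sub>M block_borel) (\<lambda>k \<omega>. (S k \<omega>, T k \<omega>)) {1..}"
    using samples by (simp add: ebrsi_samples_def)
  then have "indep_vars (\<lambda>_. block_borel \<Otimes>\<^sub>M block_borel) (\<lambda>k \<omega>. (S k \<omega>, T k \<omega>)) {1..k}"
    by (rule indep_vars_subset) auto
  moreover have "(\<lambda>\<omega>. (S i \<omega>, T i \<omega>)) \<in> measurable M (block_borel \<Otimes>\<^sub>M block_borel)" if "i \<in> {1..k}" for i
    using samples that by (auto simp: ebrsi_samples_def)
  ultimately have "distr M (\<Pi>\<^sub>M i\<in>{1..k}. block_borel \<Otimes>\<^sub>M block_borel) (\<lambda>\<omega>. \<lambda>i\<in>{1..k}. (S i \<omega>, T i \<omega>))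
    = (\<Pi>\<^sub>M i\<in>{1..k}. distr M (block_borel \<Otimes>\<^sub>M block_borel) (\<lambda>\<omega>. (S i \<omega>, T i \<omega>)))"
    \<comment> \<open>\<open>1 \<le> k\<close> makes the index set nonempty, as this
      characterisation of independence requires.\<close>
    using k by (subst (asm) indep_vars_iff_distr_eq_PiM') auto
  also have "\<dots> = (\<Pi>\<^sub>M i\<in>{1..k}. Dr \<Otimes>\<^sub>M Dc)"
    by (intro PiM_cong distr_ebrsi_sample M samples) auto
  finally show ?thesis .
qed

lemma lambda_values_c_eq: "lambda_values_c A D = lambda_values_r (transpose A) D"
  by (simp add: lambda_values_c_def lambda_values_r_def)

section \<open>Expected errors under the product law\<close>

context
  fixes A :: "real^'n::finite^'m::finite" and b z0 :: "real^'m" and x0 :: "real^'n"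
    and ac ar lc lr eps :: real
    and Dr :: "'m block measure" and Dc :: "'n block measure"
  assumes A: "A \<noteq> 0"
    and Dr: "sampling_distribution Dr" and Dc: "sampling_distribution Dc"
    and lr: "is_maximum (lambda_values_r A Dr) lr"
    and lc: "is_maximum (lambda_values_c A Dc) lc"
    and ac: "0 < ac" "ac < 2 / lc"
    and ar: "0 < ar" "ar < 2 / lr"
    and z0: "z0 \<in> (+) b ` range ((*v) A)"
    and eps: "eps > 0"
begin

text \<open>The contraction bound at a single nonzero vector fixes the sign: \<open>v\<close> for
  rows, \<open>A *v v\<close> for columns.\<close>

lemma eta_nonneg: "0 \<le> eta A ar lr" "0 \<le> eta A ac lc"
proof -
  have pos: "0 \<le> e" if "0 \<le> e * (norm u)\<^sup>2" "u \<noteq> 0" for e :: real and u :: "real^'p"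
    using that by (simp add: zero_le_mult_iff)
  obtain v where v: "v \<in> range ((*v) (transpose A))" "v \<noteq> 0"
    using range_transpose_nontrivial[OF A] subspace_0[OF subspace_range_matrix[of "transpose A"]]
    by blast
  show "0 \<le> eta A ar lr"
    unfolding eta_def
    by (rule pos[OF contraction_factor_nonneg[OF Dr lr ar sigma_min_nonneg[OF A] sigma_min_le[OF A]]])
      (use v in auto)
  have "A *v v \<noteq> 0"
    using range_matrix_transpose_orthogonal[of A v v] v by auto
  then show "0 \<le> eta A ac lc"
    unfolding eta_def
    by (intro pos[OF contraction_factor_nonneg[OF Dc lc[unfolded lambda_values_c_eq] ac
            sigma_min_nonneg[OF A] sigma_min_transpose_le[OF A]]]) auto
qed

lemma z_step:
  assumes w: "w \<in> range ((*v) A)"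
  shows "(\<integral>\<^sup>+T. ennreal ((norm (w - ac *\<^sub>R (A *v (mult_transpose T *v (transpose A *v w)))))\<^sup>2) \<partial>Dc)
    \<le> ennreal (eta A ac lc * (norm w)\<^sup>2)"
  using contraction_in_expectation[OF Dc lc[unfolded lambda_values_c_eq] ac
            sigma_min_nonneg[OF A] sigma_min_transpose_le[OF A w]]
  by (simp add: eta_def)

lemma z_step_pair:
  assumes w: "w \<in> range ((*v) A)"
  shows "(\<integral>\<^sup>+p. ennreal ((norm (w - ac *\<^sub>R (A *v (mult_transpose (snd p) *v (transpose A *v w)))))\<^sup>2) \<partial>(Dr \<Otimes>\<^sub>M Dc))
    \<le> ennreal (eta A ac lc * (norm w)\<^sup>2)" (is "(\<integral>\<^sup>+p. ?f (snd p) \<partial>_) \<le> _")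
proof -
  interpret r: prob_space Dr using Dr by (simp add: sampling_distribution_def)
  interpret c: prob_space Dc using Dc by (simp add: sampling_distribution_def)
  interpret pair_sigma_finite Dr Dc ..
  have [measurable]: "mult_transpose \<in> borel_measurable Dc"
    using Dc by (auto simp: sampling_distribution_def has_bochner_integral_iff)
  have "(\<integral>\<^sup>+p. ?f (snd p) \<partial>(Dr \<Otimes>\<^sub>M Dc)) = (\<integral>\<^sup>+T. \<integral>\<^sup>+S. ?f (snd (S, T)) \<partial>Dr \<partial>Dc)"
    by (rule nn_integral_snd[symmetric]) measurable
  also have "\<dots> = (\<integral>\<^sup>+T. ?f T \<partial>Dc)"
    by (simp add: r.emeasure_space_1)
  finally show ?thesis using z_step[OF w] by simp
qed

text \<open>Integrating over \<open>S\<close> first keeps the new \<open>z\<close> error fixed as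
  the perturbation. Averaging it over \<open>T\<close> then yields \<open>eta A ac lc\<close>, since
  the row step already uses the updated \<open>z\<close>.\<close>

lemma x_step:
  assumes v: "v \<in> range ((*v) (transpose A))" and w: "w \<in> range ((*v) A)"
  shows "(\<integral>\<^sup>+p. ennreal ((norm (v - ar *\<^sub>R (transpose A *v (mult_transpose (fst p) *v
        (A *v v + (w - ac *\<^sub>R (A *v (mult_transpose (snd p) *v (transpose A *v w)))))))))\<^sup>2) \<partial>(Dr \<Otimes>\<^sub>M Dc))
    \<le> ennreal ((1 + eps) * (eta A ar lr * (norm v)\<^sup>2)
        + (1 + 1 / eps) * (ar\<^sup>2 * (lr * (eta A ac lc * (norm w)\<^sup>2))))"
    (is "(\<integral>\<^sup>+p. ?f p \<partial>_) \<le> _")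
proof -
  interpret r: prob_space Dr using Dr by (simp add: sampling_distribution_def)
  interpret c: prob_space Dc using Dc by (simp add: sampling_distribution_def)
  interpret pair_sigma_finite Dr Dc ..
  have [measurable]: "mult_transpose \<in> borel_measurable Dr" "mult_transpose \<in> borel_measurable Dc"
    using Dr Dc by (auto simp: sampling_distribution_def has_bochner_integral_iff)
  let ?w = "\<lambda>T. w - ac *\<^sub>R (A *v (mult_transpose T *v (transpose A *v w)))"
  define C where "C = (1 + 1 / eps) * ar\<^sup>2 * lr"
  have "0 < lr" by (rule maximum_pos[OF Dr lr ar])
  then have C: "0 \<le> C" using eps by (simp add: C_def)
  define K where "K = (1 + eps) * (eta A ar lr * (norm v)\<^sup>2)"
  have K: "0 \<le> K" using eps eta_nonneg by (simp add: K_def)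
  have "(\<integral>\<^sup>+p. ?f p \<partial>(Dr \<Otimes>\<^sub>M Dc)) = (\<integral>\<^sup>+T. \<integral>\<^sup>+S. ?f (S, T) \<partial>Dr \<partial>Dc)"
    by (rule nn_integral_snd[symmetric]) measurable
  also have "\<dots> \<le> (\<integral>\<^sup>+T. ennreal K + ennreal C * ennreal ((norm (?w T))\<^sup>2) \<partial>Dc)"
  proof (rule nn_integral_mono)
    fix T
    have "(\<integral>\<^sup>+S. ?f (S, T) \<partial>Dr) \<le> ennreal (K + C * (norm (?w T))\<^sup>2)"
      using perturbed_contraction_in_expectation[OF Dr lr ar sigma_min_nonneg[OF A] sigma_min_le[OF A v] eps,
          of "?w T"]
      by (simp add: K_def C_def eta_def mult.assoc)
    then show "(\<integral>\<^sup>+S. ?f (S, T) \<partial>Dr) \<le> ennreal K + ennreal C * ennreal ((norm (?w T))\<^sup>2)"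
      using C K by (simp add: ennreal_mult ennreal_plus)
  qed
  also have "\<dots> = ennreal K + ennreal C * (\<integral>\<^sup>+T. ennreal ((norm (?w T))\<^sup>2) \<partial>Dc)"
    by (simp add: nn_integral_add nn_integral_cmult c.emeasure_space_1)
  also have "\<dots> \<le> ennreal K + ennreal C * ennreal (eta A ac lc * (norm w)\<^sup>2)"
    by (intro add_left_mono mult_left_mono z_step w) simp
  also have "\<dots> = ennreal (K + C * (eta A ac lc * (norm w)\<^sup>2))"
    using K C eta_nonneg by (simp add: ennreal_mult ennreal_plus)
  finally show ?thesis by (simp add: K_def C_def mult.assoc)
qed

abbreviation "z_err f k \<equiv> ebrsi_z A ac z0 (\<lambda>j. snd (f j)) k - (mat 1 - A ** pinv A) *v b"
abbreviation "x_err f k \<equiv> ebrsi_x A b ac ar z0 x0 (\<lambda>j. snd (f j)) (\<lambda>j. fst (f j)) k - x_star A b x0"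

text \<open>This is the shape in which Fubini separates the last sample pair \<open>p\<close> from
  the path \<open>f\<close> of earlier pairs.\<close>

lemma errors_update:
  "z_err (f(Suc k := p)) (Suc k) = z_err f k
      - ac *\<^sub>R (A *v (mult_transpose (snd p) *v (transpose A *v z_err f k)))"
  "x_err (f(Suc k := p)) (Suc k) = x_err f k - ar *\<^sub>R (transpose A *v (mult_transpose (fst p) *v
      (A *v x_err f k + (z_err f k
      - ac *\<^sub>R (A *v (mult_transpose (snd p) *v (transpose A *v z_err f k)))))))"
proof -
  have z: "ebrsi_z A ac z0 (\<lambda>j. snd ((f(Suc k := p)) j)) k = ebrsi_z A ac z0 (\<lambda>j. snd (f j)) k"
    by (rule ebrsi_z_cong) auto
  have x: "ebrsi_x A b ac ar z0 x0 (\<lambda>j. snd ((f(Suc k := p)) j)) (\<lambda>j. fst ((f(Suc k := p)) j)) k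
      = ebrsi_x A b ac ar z0 x0 (\<lambda>j. snd (f j)) (\<lambda>j. fst (f j)) k"
    by (rule ebrsi_x_cong) auto
  show z': "z_err (f(Suc k := p)) (Suc k) = z_err f k
      - ac *\<^sub>R (A *v (mult_transpose (snd p) *v (transpose A *v z_err f k)))"
    unfolding ebrsi_z_error_Suc z by simp
  show "x_err (f(Suc k := p)) (Suc k) = x_err f k - ar *\<^sub>R (transpose A *v (mult_transpose (fst p) *v
      (A *v x_err f k + (z_err f k
      - ac *\<^sub>R (A *v (mult_transpose (snd p) *v (transpose A *v z_err f k)))))))"
    unfolding ebrsi_x_error_Suc z' x by simp
qed

lemma measurable_errors [measurable]:
  assumes "{1..k} \<subseteq> I"
  shows "(\<lambda>f. z_err f k) \<in> borel_measurable (\<Pi>\<^sub>M i\<in>I. Dr \<Otimes>\<^sub>M Dc)"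
    "(\<lambda>f. x_err f k) \<in> borel_measurable (\<Pi>\<^sub>M i\<in>I. Dr \<Otimes>\<^sub>M Dc)"
proof -
  have [measurable]: "mult_transpose \<in> borel_measurable Dr" "mult_transpose \<in> borel_measurable Dc"
    using Dr Dc by (auto simp: sampling_distribution_def has_bochner_integral_iff)
  have samples: "(\<lambda>f. mult_transpose (fst (f j))) \<in> borel_measurable (\<Pi>\<^sub>M i\<in>I. Dr \<Otimes>\<^sub>M Dc)"
    "(\<lambda>f. mult_transpose (snd (f j))) \<in> borel_measurable (\<Pi>\<^sub>M i\<in>I. Dr \<Otimes>\<^sub>M Dc)" if "1 \<le> j" "j \<le> k" for j
  proof -
    have [measurable]: "j \<in> I" using assms that by auto
    show "(\<lambda>f. mult_transpose (fst (f j))) \<in> borel_measurable (\<Pi>\<^sub>M i\<in>I. Dr \<Otimes>\<^sub>M Dc)"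
      "(\<lambda>f. mult_transpose (snd (f j))) \<in> borel_measurable (\<Pi>\<^sub>M i\<in>I. Dr \<Otimes>\<^sub>M Dc)"
      by measurable
  qed
  show "(\<lambda>f. z_err f k) \<in> borel_measurable (\<Pi>\<^sub>M i\<in>I. Dr \<Otimes>\<^sub>M Dc)"
    by (intro borel_measurable_diff borel_measurable_const borel_measurable_ebrsi_z samples)
  show "(\<lambda>f. x_err f k) \<in> borel_measurable (\<Pi>\<^sub>M i\<in>I. Dr \<Otimes>\<^sub>M Dc)"
    by (intro borel_measurable_diff borel_measurable_const borel_measurable_ebrsi_x samples)
qed

definition "error_bound k =
  (1 + eps) ^ k * eta A ar lr ^ k * (norm (x0 - x_star A b x0))\<^sup>2
        + (1 + 1 / eps) * ar\<^sup>2 * lr * (norm (z0 - (mat 1 - A ** pinv A) *v b))\<^sup>2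
          * (\<Sum>i<k. eta A ac lc ^ (k - i) * (1 + eps) ^ i * eta A ar lr ^ i)"

lemma error_bound_Suc:
  "error_bound (Suc k) = (1 + eps) * (eta A ar lr * error_bound k)
    + (1 + 1 / eps) * (ar\<^sup>2 * (lr * (eta A ac lc *
        (eta A ac lc ^ k * (norm (z0 - (mat 1 - A ** pinv A) *v b))\<^sup>2))))"
proof -
  define Q where "Q = (\<Sum>i<k. eta A ac lc ^ (k - i) * (1 + eps) ^ i * eta A ar lr ^ i)"
  \<comment> \<open>The term \<open>i = 0\<close> splits off. After the shift
    \<open>Suc k - Suc i = k - i\<close>, so every other term only gains the factor
    \<open>(1 + eps) * eta A ar lr\<close>.\<close>
  have sum: "(\<Sum>i<Suc k. eta A ac lc ^ (Suc k - i) * (1 + eps) ^ i * eta A ar lr ^ i)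
      = eta A ac lc * eta A ac lc ^ k + (1 + eps) * eta A ar lr * Q"
    unfolding Q_def by (subst sum.lessThan_Suc_shift) (simp add: sum_distrib_left mult_ac)
  have "(e * p) * (r * q) * X + c * a * l * N * (g * h + e * r * Q)
      = e * (r * (p * q * X + c * a * l * N * Q)) + c * (a * (l * (g * (h * N))))"
    for e p r q X c a l N g h :: real
    by (simp add: algebra_simps)
  then show ?thesis
    by (simp only: error_bound_def sum Q_def[symmetric] power_Suc)
qed

lemma error_bound_nonneg: "0 \<le> error_bound k"
  unfolding error_bound_def using eta_nonneg eps ar maximum_pos[OF Dr lr ar]
  by (intro add_nonneg_nonneg mult_nonneg_nonneg sum_nonneg zero_le_power) auto

text \<open>Both bounds run through one induction because the step for \<open>x\<close> uses the
  \<open>z\<close> bound at \<open>k\<close>. The last coordinate is integrated innermost, with the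
  earlier path fixed.\<close>

lemma expected_errors:
  shows "(\<integral>\<^sup>+f. ennreal ((norm (z_err f k))\<^sup>2) \<partial>(\<Pi>\<^sub>M i\<in>{1..k}. Dr \<Otimes>\<^sub>M Dc))
      \<le> ennreal (eta A ac lc ^ k * (norm (z0 - (mat 1 - A ** pinv A) *v b))\<^sup>2)"
    and "(\<integral>\<^sup>+f. ennreal ((norm (x_err f k))\<^sup>2) \<partial>(\<Pi>\<^sub>M i\<in>{1..k}. Dr \<Otimes>\<^sub>M Dc))
      \<le> ennreal (error_bound k)"
proof (induction k)
  case 0
  {
    case 1
    \<comment> \<open>Over the empty index set the product is the unit mass at one point.\<close>
    show ?case by (simp add: PiM_empty nn_integral_count_space_finite)
  next
    case 2
    show ?case by (simp add: PiM_empty nn_integral_count_space_finite error_bound_def)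
  }
next
  case (Suc k)
  interpret r: prob_space Dr using Dr by (simp add: sampling_distribution_def)
  interpret c: prob_space Dc using Dc by (simp add: sampling_distribution_def)
  interpret rc: pair_prob_space Dr Dc ..
  interpret product_sigma_finite "\<lambda>_ :: nat. Dr \<Otimes>\<^sub>M Dc" ..
  let ?P = "\<Pi>\<^sub>M i\<in>{1..k}. Dr \<Otimes>\<^sub>M Dc"
  have ins: "{1..Suc k} = insert (Suc k) {1..k}" by auto
  have split: "(\<integral>\<^sup>+f. g f \<partial>(\<Pi>\<^sub>M i\<in>{1..Suc k}. Dr \<Otimes>\<^sub>M Dc)) = (\<integral>\<^sup>+f. \<integral>\<^sup>+p. g (f(Suc k := p)) \<partial>(Dr \<Otimes>\<^sub>M Dc) \<partial>?P)"
    if "g \<in> borel_measurable (\<Pi>\<^sub>M i\<in>{1..Suc k}. Dr \<Otimes>\<^sub>M Dc)" for g :: "_ \<Rightarrow> ennreal"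
    using that unfolding ins by (intro product_nn_integral_insert) auto
  note [measurable] = measurable_errors[OF order_refl]
  {
    case 1
    have "(\<integral>\<^sup>+f. ennreal ((norm (z_err f (Suc k)))\<^sup>2) \<partial>(\<Pi>\<^sub>M i\<in>{1..Suc k}. Dr \<Otimes>\<^sub>M Dc))
      = (\<integral>\<^sup>+f. \<integral>\<^sup>+p. ennreal ((norm (z_err (f(Suc k := p)) (Suc k)))\<^sup>2) \<partial>(Dr \<Otimes>\<^sub>M Dc) \<partial>?P)"
      by (rule split) measurable
    \<comment> \<open>Range membership of the error holds on every path, so the one-step bound
      applies pointwise in \<open>f\<close>.\<close>
    also have "\<dots> \<le> (\<integral>\<^sup>+f. ennreal (eta A ac lc) * ennreal ((norm (z_err f k))\<^sup>2) \<partial>?P)"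
      unfolding errors_update
      by (intro nn_integral_mono order_trans[OF z_step_pair] ebrsi_z_error_in_range z0)
        (simp add: ennreal_mult eta_nonneg)
    also have "\<dots> = ennreal (eta A ac lc) * (\<integral>\<^sup>+f. ennreal ((norm (z_err f k))\<^sup>2) \<partial>?P)"
      by (rule nn_integral_cmult) measurable
    also have "\<dots> \<le> ennreal (eta A ac lc) * ennreal (eta A ac lc ^ k * (norm (z0 - (mat 1 - A ** pinv A) *v b))\<^sup>2)"
      by (intro mult_left_mono Suc) simp
    also have "\<dots> = ennreal (eta A ac lc ^ Suc k * (norm (z0 - (mat 1 - A ** pinv A) *v b))\<^sup>2)"
      using eta_nonneg by (simp add: ennreal_mult[symmetric] mult.assoc)
    finally show ?case .
  next
    case 2
    define K C where "K = (1 + eps) * eta A ar lr" and "C = (1 + 1 / eps) * (ar\<^sup>2 * (lr * eta A ac lc))"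
    have K: "0 \<le> K" and C: "0 \<le> C"
      using eps eta_nonneg maximum_pos[OF Dr lr ar] by (simp_all add: K_def C_def)
    have "(\<integral>\<^sup>+f. ennreal ((norm (x_err f (Suc k)))\<^sup>2) \<partial>(\<Pi>\<^sub>M i\<in>{1..Suc k}. Dr \<Otimes>\<^sub>M Dc))
      = (\<integral>\<^sup>+f. \<integral>\<^sup>+p. ennreal ((norm (x_err (f(Suc k := p)) (Suc k)))\<^sup>2) \<partial>(Dr \<Otimes>\<^sub>M Dc) \<partial>?P)"
      by (rule split) measurable
    also have "\<dots> \<le> (\<integral>\<^sup>+f. ennreal K * ennreal ((norm (x_err f k))\<^sup>2) + ennreal C * ennreal ((norm (z_err f k))\<^sup>2) \<partial>?P)"
      unfolding errors_update
    proof (intro nn_integral_mono order_trans[OF x_step] ebrsi_z_error_in_range ebrsi_x_error_in_range z0)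
      fix f
      show "ennreal ((1 + eps) * (eta A ar lr * (norm (x_err f k))\<^sup>2)
          + (1 + 1 / eps) * (ar\<^sup>2 * (lr * (eta A ac lc * (norm (z_err f k))\<^sup>2))))
        \<le> ennreal K * ennreal ((norm (x_err f k))\<^sup>2) + ennreal C * ennreal ((norm (z_err f k))\<^sup>2)"
        using K C by (simp add: ennreal_mult[symmetric] ennreal_plus[symmetric] del: ennreal_plus)
          (simp add: K_def C_def mult.assoc)
    qed
    also have "\<dots> = ennreal K * (\<integral>\<^sup>+f. ennreal ((norm (x_err f k))\<^sup>2) \<partial>?P)
        + ennreal C * (\<integral>\<^sup>+f. ennreal ((norm (z_err f k))\<^sup>2) \<partial>?P)"
      by (simp add: nn_integral_add nn_integral_cmult)
    also have "\<dots> \<le> ennreal K * ennreal (error_bound k)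
        + ennreal C * ennreal (eta A ac lc ^ k * (norm (z0 - (mat 1 - A ** pinv A) *v b))\<^sup>2)"
      by (intro add_mono mult_left_mono Suc) simp_all
    also have "\<dots> = ennreal (K * error_bound k + C * (eta A ac lc ^ k * (norm (z0 - (mat 1 - A ** pinv A) *v b))\<^sup>2))"
      using K C eta_nonneg error_bound_nonneg by (simp add: ennreal_mult ennreal_plus)
    also have "\<dots> = ennreal (error_bound (Suc k))"
      by (simp add: error_bound_Suc K_def C_def mult.assoc)
    finally show ?case .
  }
qed

lemma expected_error_on_samples:
  fixes k :: nat
  assumes M: "prob_space M" and samples: "ebrsi_samples M Dr Dc S T"
  defines "X \<equiv> \<lambda>\<omega>. (norm (ebrsi_x A b ac ar z0 x0 (\<lambda>j. T j \<omega>) (\<lambda>j. S j \<omega>) k - x_star A b x0))\<^sup>2"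
  shows "integrable M X" and "integral\<^sup>L M X \<le> error_bound k"
proof -
  interpret prob_space M by fact
  let ?N = "\<Pi>\<^sub>M i\<in>{1..k}. block_borel \<Otimes>\<^sub>M block_borel"
  let ?Y = "\<lambda>\<omega>. \<lambda>i\<in>{1..k}. (S i \<omega>, T i \<omega>)"
  have [measurable]: "S j \<in> measurable M block_borel" "T j \<in> measurable M block_borel" if "1 \<le> j" for j
    using samples that by (auto simp: ebrsi_samples_def)
  have mult_meas: "(\<lambda>\<omega>. mult_transpose (S j \<omega>)) \<in> borel_measurable M"
    "(\<lambda>\<omega>. mult_transpose (T j \<omega>)) \<in> borel_measurable M" if "1 \<le> j" for j
    using that borel_measurable_mult_transpose[OF Dr] borel_measurable_mult_transpose[OF Dc] by measurable
  have "(\<lambda>\<omega>. ebrsi_x A b ac ar z0 x0 (\<lambda>j. T j \<omega>) (\<lambda>j. S j \<omega>) k) \<in> borel_measurable M"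
    by (intro borel_measurable_ebrsi_x mult_meas)
  then have X[measurable]: "X \<in> borel_measurable M"
    unfolding X_def by measurable
  have "(\<integral>\<^sup>+\<omega>. ennreal (X \<omega>) \<partial>M) = (\<integral>\<^sup>+f. ennreal ((norm (x_err f k))\<^sup>2) \<partial>(\<Pi>\<^sub>M i\<in>{1..k}. Dr \<Otimes>\<^sub>M Dc))"
  \<comment> \<open>The law of the samples was identified for \<open>1 \<le> k\<close> only.\<close>
  proof (cases "k = 0")
    case True
    then show ?thesis
      by (simp add: X_def PiM_empty nn_integral_count_space_finite emeasure_space_1)
  next
    case False
    then have law: "distr M ?N ?Y = (\<Pi>\<^sub>M i\<in>{1..k}. Dr \<Otimes>\<^sub>M Dc)"
      by (intro distr_ebrsi_samples M samples) simp
    have "(\<lambda>f. ennreal ((norm (x_err f k))\<^sup>2)) \<in> borel_measurable (distr M ?N ?Y)"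
      unfolding law using measurable_errors(2)[OF order_refl, of k] by measurable
    then have "(\<integral>\<^sup>+f. ennreal ((norm (x_err f k))\<^sup>2) \<partial>distr M ?N ?Y)
        = (\<integral>\<^sup>+\<omega>. ennreal ((norm (x_err (?Y \<omega>) k))\<^sup>2) \<partial>M)"
      by (intro nn_integral_distr) (auto intro!: measurable_restrict)
    \<comment> \<open>Outside \<open>{1..k}\<close> the restricted path is \<open>undefined\<close>,
      which iterate \<open>k\<close> never reads.\<close>
    moreover have "ebrsi_x A b ac ar z0 x0 (\<lambda>j. snd (?Y \<omega> j)) (\<lambda>j. fst (?Y \<omega> j)) k
        = ebrsi_x A b ac ar z0 x0 (\<lambda>j. T j \<omega>) (\<lambda>j. S j \<omega>) k" for \<omega>
      by (rule ebrsi_x_cong) auto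
    ultimately show ?thesis
      unfolding law X_def by simp
  qed
  also have "\<dots> \<le> ennreal (error_bound k)"
    by (rule expected_errors)
  finally have le: "(\<integral>\<^sup>+\<omega>. ennreal (X \<omega>) \<partial>M) \<le> ennreal (error_bound k)" .
  have nonneg: "0 \<le> X \<omega>" for \<omega> by (simp add: X_def)
  \<comment> \<open>Integrability first: it lets the Bochner integral, 0 by convention otherwise, be
    identified with the extended one.\<close>
  show int: "integrable M X"
    using le nonneg by (intro integrableI_nonneg) (auto intro: le_less_trans)
  show "integral\<^sup>L M X \<le> error_bound k"
    using le nonneg error_bound_nonneg nn_integral_eq_integral[OF int] by simp
qed

end

theorem theorem11:
  fixes A :: "real^'n::finite^'m::finite" and b z0 :: "real^'m" and x0 :: "real^'n"
    and ac ar lc lr eps :: real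
    and Dr :: "'m block measure" and Dc :: "'n block measure"
    and M :: "'a measure"
    and S :: "nat \<Rightarrow> 'a \<Rightarrow> 'm block" and T :: "nat \<Rightarrow> 'a \<Rightarrow> 'n block"
    and k :: nat
  assumes "A \<noteq> 0"
    and "sampling_distribution Dr" and "sampling_distribution Dc"
    and "is_maximum (lambda_values_r A Dr) lr"
    and "is_maximum (lambda_values_c A Dc) lc"
    and "0 < ac" and "ac < 2 / lc"
    and "0 < ar" and "ar < 2 / lr"
    and "z0 \<in> (+) b ` range ((*v) A)"
    and "prob_space M" and "ebrsi_samples M Dr Dc S T"
    and "eps > 0"
  shows "integrable M (\<lambda>\<omega>. (norm (ebrsi_x A b ac ar z0 x0 (\<lambda>j. T j \<omega>) (\<lambda>j. S j \<omega>) k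
             - x_star A b x0))\<^sup>2) \<and>
    prob_space.expectation M (\<lambda>\<omega>. (norm (ebrsi_x A b ac ar z0 x0 (\<lambda>j. T j \<omega>) (\<lambda>j. S j \<omega>) k
             - x_star A b x0))\<^sup>2)
      \<le> (1 + eps) ^ k * eta A ar lr ^ k * (norm (x0 - x_star A b x0))\<^sup>2
        + (1 + 1 / eps) * ar\<^sup>2 * lr * (norm (z0 - (mat 1 - A ** pinv A) *v b))\<^sup>2
          * (\<Sum>i<k. eta A ac lc ^ (k - i) * (1 + eps) ^ i * eta A ar lr ^ i)"
  unfolding error_bound_def[OF assms(1-10,13), symmetric]
  by (intro conjI expected_error_on_samples[OF assms(1-10,13,11,12)])

end
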